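(* There is an algorithm which, given two subshifts of finite type $X$ and $Y$ (each given by a finite alphabet and a finite forbidden language), decides whether $X$ and $Y$ are directly conjugate, i.e. whether there exist positive integers $M$ and $N$ such that $X^{[M]}$ and $Y^{[N]}$ are similar.
   Context: Words over a finite alphabet $\mathcal{A}$ may be finite, infinite (indexed by $\mathbb{N}$) or bi-infinite (indexed by $\mathbb{Z}$); a word set is any set of such words. A projection is a map between alphabets, extended letter by letter to words and word sets. For word sets $X,Y$ write $X\succcurlyeq Y$ if there is a projection $\varphi$ with $\varphi(X)=Y$; $X$ and $Y$ are similar ($X\sim Y$) if $X\succcurlyeq Y$ and $Y\succcurlyeq X$ (equal up to renaming letters). For $N\ge1$, the $N$-th higher block code $\Phi_N$ maps a word $u$ to the word over the alphabet of blocks $\{[w] : w\in\mathcal{A}^N\}$ given by $(\Phi_N(u))_i=[u_iu_{i+1}\dots u_{i+N-1}]$ for all positions $i$ with $i+N-1$ a position of $u$; the $N$-block presentation of a word set $X$ is $X^{[N]}=\Phi_N(X)$. The shift $\sigma$ on $\mathcal{A}^{\mathbb{Z}}$ is $\sigma(u)_n=u_{n+1}$. A subshift is a closed, shift-invariant subset of $\mathcal{A}^{\mathbb{Z}}$; it is of finite type (SFT) if it equals the set of bi-infinite words avoiding some finite set $F$ of finite words (a forbidden language). *)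

theory Defs
  imports Main "HOL-Library.Nat_Bijection"
begin

type_synonym 'a biword = "int \<Rightarrow> 'a"

definition full_shift :: "'a set \<Rightarrow> 'a biword set" where
  "full_shift A = {u. \<forall>i. u i \<in> A}"

definition occurs_in :: "'a list \<Rightarrow> 'a biword \<Rightarrow> bool" where
  "occurs_in w u \<longleftrightarrow> (\<exists>i. \<forall>j < length w. u (i + int j) = w ! j)"

definition sft :: "'a set \<Rightarrow> 'a list set \<Rightarrow> 'a biword set" where
  "sft A F = {u \<in> full_shift A. \<forall>w \<in> F. \<not> occurs_in w u}"

text \<open>Word sets are paired with their alphabets, since a projection is a map between alphabets:
  \<open>projects_onto A X B Y\<close> is \<open>X \<succcurlyeq> Y\<close> for \<open>X\<close> over \<open>A\<close> and \<open>Y\<close> over \<open>B\<close>.\<close>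

definition projects_onto :: "'a set \<Rightarrow> 'a biword set \<Rightarrow> 'b set \<Rightarrow> 'b biword set \<Rightarrow> bool" where
  "projects_onto A X B Y \<longleftrightarrow> (\<exists>\<phi>. \<phi> ` A \<subseteq> B \<and> (\<lambda>u. \<phi> \<circ> u) ` X = Y)"

definition similar :: "'a set \<Rightarrow> 'a biword set \<Rightarrow> 'b set \<Rightarrow> 'b biword set \<Rightarrow> bool" where
  "similar A X B Y \<longleftrightarrow> projects_onto A X B Y \<and> projects_onto B Y A X"

text \<open>The letter \<open>[w]\<close> of the block alphabet is represented by the list \<open>w\<close> itself.\<close>

definition block_alphabet :: "nat \<Rightarrow> 'a set \<Rightarrow> 'a list set" where
  "block_alphabet N A = {w. length w = N \<and> set w \<subseteq> A}"

definition block_code :: "nat \<Rightarrow> 'a biword \<Rightarrow> 'a list biword" where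
  "block_code N u = (\<lambda>i. map (\<lambda>j. u (i + int j)) [0..<N])"

definition block_presentation :: "nat \<Rightarrow> 'a biword set \<Rightarrow> 'a list biword set" where
  "block_presentation N X = block_code N ` X"

definition directly_conjugate ::
  "'a set \<Rightarrow> 'a biword set \<Rightarrow> 'b set \<Rightarrow> 'b biword set \<Rightarrow> bool" where
  "directly_conjugate A X B Y \<longleftrightarrow>
     (\<exists>M N. M \<ge> 1 \<and> N \<ge> 1 \<and>
       similar (block_alphabet M A) (block_presentation M X)
               (block_alphabet N B) (block_presentation N Y))"

text \<open>Kleene's partial recursive functions, as syntactic objects with a big-step evaluation
  relation on tuples of natural numbers. In \<open>Prec\<close> and \<open>Mu\<close> the recursion variable comes first.\<close>

datatype recf =
    Zero
  | Succ
  | Proj nat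
  | Comp recf "recf list"
  | Prec recf recf
  | Mu recf

inductive evals :: "recf \<Rightarrow> nat list \<Rightarrow> nat \<Rightarrow> bool" where
  Zero: "evals Zero xs 0"
| Succ: "evals Succ [x] (Suc x)"
| Proj: "i < length xs \<Longrightarrow> evals (Proj i) xs (xs ! i)"
| Comp: "list_all2 (\<lambda>g y. evals g xs y) gs ys \<Longrightarrow> evals f ys z \<Longrightarrow> evals (Comp f gs) xs z"
| Prec_0: "evals f xs y \<Longrightarrow> evals (Prec f g) (0 # xs) y"
| Prec_Suc: "evals (Prec f g) (n # xs) y \<Longrightarrow> evals g (n # y # xs) z \<Longrightarrow>
    evals (Prec f g) (Suc n # xs) z"
| Mu: "evals f (n # xs) 0 \<Longrightarrow> (\<forall>m < n. \<exists>k. evals f (m # xs) (Suc k)) \<Longrightarrow> evals (Mu f) xs n"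

inductive_cases evals_ZeroE: "evals Zero xs z"
inductive_cases evals_SuccE: "evals Succ xs z"
inductive_cases evals_ProjE: "evals (Proj i) xs z"
inductive_cases evals_CompE: "evals (Comp f gs) xs z"
inductive_cases evals_Prec_0E: "evals (Prec f g) (0 # xs) z"
inductive_cases evals_Prec_SucE: "evals (Prec f g) (Suc n # xs) z"
inductive_cases evals_MuE: "evals (Mu f) xs z"

lemma evals_deterministic: "evals p xs y \<Longrightarrow> evals p xs z \<Longrightarrow> y = z"
proof (induction arbitrary: z rule: evals.induct)
  case (Zero xs)
  then show ?case by (rule evals_ZeroE) simp
next
  case (Succ x)
  then show ?case by (rule evals_SuccE) simp
next
  case (Proj i xs)
  from Proj.prems show ?case by (rule evals_ProjE) simp
next
  case (Comp xs gs ys f z z')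
  from Comp.prems obtain ys' where
    ys': "list_all2 (\<lambda>g y. evals g xs y) gs ys'" "evals f ys' z'"
    by (rule evals_CompE)
  have "ys = ys'"
  proof (rule nth_equalityI)
    show "length ys = length ys'"
      using list_all2_lengthD[OF Comp.IH(1)] list_all2_lengthD[OF ys'(1)] by simp
    show "ys ! i = ys' ! i" if "i < length ys" for i
      using list_all2_nthD2[OF Comp.IH(1) that] list_all2_nthD2[OF ys'(1), of i] that
        list_all2_lengthD[OF Comp.IH(1)] list_all2_lengthD[OF ys'(1)] by simp
  qed
  then show ?case using Comp.IH(2) ys'(2) by simp
next
  case (Prec_0 f xs y g)
  from Prec_0.prems show ?case by (rule evals_Prec_0E) (rule Prec_0.IH)
next
  case (Prec_Suc f g n xs y z z')
  from Prec_Suc.prems obtain y' where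
    "evals (Prec f g) (n # xs) y'" "evals g (n # y' # xs) z'"
    by (rule evals_Prec_SucE)
  then show ?case using Prec_Suc.IH by blast
next
  case (Mu f n xs z)
  from Mu.prems have z: "evals f (z # xs) 0" "\<forall>m < z. \<exists>k. evals f (m # xs) (Suc k)"
    by (auto elim: evals_MuE)
  have "\<not> n < z" using z(2) Mu.IH(1) by (metis nat.distinct(1))
  moreover have "\<not> z < n" using z(1) Mu.IH(2) by (metis nat.distinct(1))
  ultimately show ?case by simp
qed

text \<open>Letters are natural numbers, so that a finite alphabet and a finite forbidden language can be
  handed to an algorithm as the two numbers below; both encodings are injective on finite sets.\<close>

definition encode_alphabet :: "nat set \<Rightarrow> nat" where
  "encode_alphabet A = set_encode A"

definition encode_language :: "nat list set \<Rightarrow> nat" where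
  "encode_language F = set_encode (list_encode ` F)"

definition sft_presentation :: "'a set \<Rightarrow> 'a list set \<Rightarrow> bool" where
  "sft_presentation A F \<longleftrightarrow> finite A \<and> finite F \<and> F \<subseteq> lists A"

end

theory Submission
  imports Defs
begin

text \<open>
  A similarity of \<open>X\<^sup>[\<^sup>M\<^sup>]\<close> and \<open>Y\<^sup>[\<^sup>N\<^sup>]\<close> amounts to a shift-commuting correspondence between
  \<open>X\<close> and \<open>Y\<close> under which the windows \<open>x[0,M)\<close> and \<open>y[0,N)\<close> determine each other. Such a
  correspondence for \<open>(M, N)\<close> is one for \<open>(M + 1, N + 1)\<close>; conversely, if both shifts are defined by
  forbidden words of length at most \<open>m \<le> M, N\<close>, two words with a common \<open>M\<close>-window can be glued
  along it, which gives the descent from \<open>(M + 1, N + 1)\<close> to \<open>(M, N)\<close>. Hence one may assume \<open>M = m\<close>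
  or \<open>N = m\<close>. If \<open>M = m\<close>, then \<open>Y\<close> has at most \<open>q\<^sup>m\<close> words of length \<open>N\<close>, where \<open>q\<close> bounds the
  size of the alphabets, so that the complexity of \<open>Y\<close> stalls
  at some \<open>n \<le> m + q\<^sup>m\<close> unless \<open>N\<close> is already small; from there on the \<open>n\<close>-window determines all
  longer ones, and \<open>N\<close> can be replaced by \<open>n\<close>. It remains to test finitely many pairs \<open>(M, N)\<close>, each by
  a finite search for mutually inverse maps between the words of length \<open>M\<close> and \<open>N\<close> that are
  compatible with the overlaps of consecutive windows. A word belongs to the language iff it lies in a finite
  set of allowed words each of which has a successor and a predecessor in the set. With words written
  as numbers in base \<open>q\<close>, the whole test is an arithmetic formula with bounded quantifiers.
\<close>

section \<open>Recursive functions\<close>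

text \<open>Variables are entries of an environment \<open>e\<close>, of which only \<open>e 0, \<dots>, e (k - 1)\<close> are passed to the
  program. Passing under a binder shifts the environment by one, so that computability of a
  formula with nested bounded quantifiers is a matter of applying introduction rules.\<close>

definition recursive_fn :: "nat \<Rightarrow> ((nat \<Rightarrow> nat) \<Rightarrow> nat) \<Rightarrow> bool" where
  "recursive_fn k f \<longleftrightarrow> (\<exists>p. \<forall>e. evals p (map e [0..<k]) (f e))"

definition decidable :: "nat \<Rightarrow> ((nat \<Rightarrow> nat) \<Rightarrow> bool) \<Rightarrow> bool" where
  "decidable k P \<longleftrightarrow> recursive_fn k (\<lambda>e. of_bool (P e))"

text \<open>\<open>case_nat a e\<close> is the environment \<open>e\<close> with \<open>a\<close>
  pushed in front, so entering a binder puts one more argument at the head of the list.\<close>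

lemma map_case_nat_upt: "map (case_nat a e) [0..<Suc k] = a # map e [0..<k]"
  by (simp add: map_upt_Suc del: upt_Suc)

lemma recursive_var: "i < k \<Longrightarrow> recursive_fn k (\<lambda>e. e i)"
  unfolding recursive_fn_def
  using evals.Proj[of i "map e [0..<k]" for e] by (intro exI[of _ "Proj i"]) simp

text \<open>The environment handed to \<open>f\<close> indexes into the list of computed values. Its
  entries past the end are unspecified, but the program for \<open>f\<close> receives only the first
  \<open>length gs\<close> of them.\<close>

lemma recursive_compose:
  assumes f: "recursive_fn (length gs) f" and gs: "\<forall>g \<in> set gs. recursive_fn k g"
  shows "recursive_fn k (\<lambda>e. f ((!) (map (\<lambda>g. g e) gs)))"
proof -
  obtain p where p: "\<And>e. evals p (map e [0..<length gs]) (f e)"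
    using f by (auto simp: recursive_fn_def)
  obtain q where q: "\<And>g e. g \<in> set gs \<Longrightarrow> evals (q g) (map e [0..<k]) (g e)"
    using gs unfolding recursive_fn_def by metis
  have "evals (Comp p (map q gs)) (map e [0..<k]) (f ((!) (map (\<lambda>g. g e) gs)))" for e
  proof (rule evals.Comp)
    show "list_all2 (\<lambda>g y. evals g (map e [0..<k]) y) (map q gs) (map (\<lambda>g. g e) gs)"
      using q by (simp add: list_all2_conv_all_nth)
    have "map ((!) (map (\<lambda>g. g e) gs)) [0..<length gs] = map (\<lambda>g. g e) gs"
      by (rule nth_equalityI) auto
    with p[of "(!) (map (\<lambda>g. g e) gs)"]
    show "evals p (map (\<lambda>g. g e) gs) (f ((!) (map (\<lambda>g. g e) gs)))" by simp
  qed
  then show ?thesis unfolding recursive_fn_def by blast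
qed

lemma recursive_compose1:
  assumes "recursive_fn 1 (\<lambda>e. f (e 0))" "recursive_fn k a"
  shows "recursive_fn k (\<lambda>e. f (a e))"
  using recursive_compose[of "[a]" "\<lambda>e. f (e 0)" k] assms by simp

lemma recursive_compose2:
  assumes "recursive_fn 2 (\<lambda>e. f (e 0) (e 1))" "recursive_fn k a" "recursive_fn k b"
  shows "recursive_fn k (\<lambda>e. f (a e) (b e))"
  using recursive_compose[of "[a, b]" "\<lambda>e. f (e 0) (e 1)" k] assms by (simp add: numeral_2_eq_2)

lemma recursive_Suc: "recursive_fn k a \<Longrightarrow> recursive_fn k (\<lambda>e. Suc (a e))"
  by (rule recursive_compose1)
    (auto simp: recursive_fn_def intro: exI[of _ Succ] evals.Succ)

lemma recursive_const: "recursive_fn k (\<lambda>e. c)"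
proof (induction c)
  case 0
  show ?case unfolding recursive_fn_def using evals.Zero by blast
next
  case (Suc c)
  then show ?case by (rule recursive_Suc)
qed

lemma recursive_rec_nat:
  assumes n: "recursive_fn k n" and a: "recursive_fn k a"
    and g: "recursive_fn (Suc (Suc k)) (\<lambda>e. g (e 0) (e (Suc 0)) (\<lambda>j. e (Suc (Suc j))))"
  shows "recursive_fn k (\<lambda>e. rec_nat (a e) (\<lambda>i y. g i y e) (n e))"
proof -
  obtain p where p: "\<And>e. evals p (map e [0..<k]) (a e)"
    using a by (auto simp: recursive_fn_def)
  obtain q where q: "\<And>e. evals q (map e [0..<Suc (Suc k)]) (g (e 0) (e (Suc 0)) (\<lambda>j. e (Suc (Suc j))))"
    using g unfolding recursive_fn_def by blast
  have q': "evals q (i # y # map e [0..<k]) (g i y e)" for i y e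
    using q[of "case_nat i (case_nat y e)"] unfolding map_case_nat_upt by simp
  have r: "evals (Prec p q) (m # map e [0..<k]) (rec_nat (a e) (\<lambda>i y. g i y e) m)" for m e
    by (induction m) (auto intro: evals.Prec_0 evals.Prec_Suc p q')
  have "recursive_fn (Suc k) (\<lambda>e. rec_nat (a (\<lambda>j. e (Suc j))) (\<lambda>i y. g i y (\<lambda>j. e (Suc j))) (e 0))"
    unfolding recursive_fn_def
  proof (intro exI allI)
    fix e :: "nat \<Rightarrow> nat"
    have "map e [0..<Suc k] = e 0 # map (\<lambda>j. e (Suc j)) [0..<k]"
      by (simp add: map_upt_Suc del: upt_Suc)
    then show "evals (Prec p q) (map e [0..<Suc k])
        (rec_nat (a (\<lambda>j. e (Suc j))) (\<lambda>i y. g i y (\<lambda>j. e (Suc j))) (e 0))"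
      using r[of "e 0" "\<lambda>j. e (Suc j)"] by simp
  qed
  then obtain p' where p': "\<And>e. evals p' (map e [0..<Suc k])
      (rec_nat (a (\<lambda>j. e (Suc j))) (\<lambda>i y. g i y (\<lambda>j. e (Suc j))) (e 0))"
    unfolding recursive_fn_def by blast
  have p'': "evals p' (n e # map e [0..<k]) (rec_nat (a e) (\<lambda>i y. g i y e) (n e))" for e
    using p'[of "case_nat (n e) e"] unfolding map_case_nat_upt by simp
  obtain s where s: "\<And>e. evals s (map e [0..<k]) (n e)"
    using n by (auto simp: recursive_fn_def)
  \<comment> \<open>The program \<open>p'\<close> expects the number of iterations in front of the
    arguments: \<open>s\<close> computes it, and projections pass the arguments on.\<close>
  have "evals (Comp p' (s # map Proj [0..<k])) (map e [0..<k]) (rec_nat (a e) (\<lambda>i y. g i y e) (n e))" for e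
  proof (rule evals.Comp[OF _ p''])
    have "evals (Proj i) (map e [0..<k]) (e i)" if "i < k" for i
      using evals.Proj[of i "map e [0..<k]"] that by simp
    then show "list_all2 (\<lambda>g y. evals g (map e [0..<k]) y) (s # map Proj [0..<k]) (n e # map e [0..<k])"
      using s by (simp add: list_all2_conv_all_nth nth_Cons split: nat.split)
  qed
  then show ?thesis unfolding recursive_fn_def by blast
qed

section \<open>Arithmetic operations and bounded sums\<close>

lemma recursive_add: "recursive_fn k a \<Longrightarrow> recursive_fn k b \<Longrightarrow> recursive_fn k (\<lambda>e. a e + b e)"
proof (rule recursive_compose2[of "(+)"])
  have "rec_nat y (\<lambda>i z. Suc z) x = x + y" for x y by (induction x) auto
  moreover have "recursive_fn 2 (\<lambda>e. rec_nat (e 1) (\<lambda>i z. Suc z) (e 0))"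
    by (intro recursive_rec_nat recursive_Suc recursive_var) auto
  ultimately show "recursive_fn 2 (\<lambda>e. e 0 + e 1)" by simp
qed

lemma recursive_mult: "recursive_fn k a \<Longrightarrow> recursive_fn k b \<Longrightarrow> recursive_fn k (\<lambda>e. a e * b e)"
proof (rule recursive_compose2[of "(*)"])
  have "rec_nat 0 (\<lambda>i z. z + y) x = x * y" for x y :: nat by (induction x) auto
  moreover have "recursive_fn 2 (\<lambda>e. rec_nat 0 (\<lambda>i z. z + e 1) (e 0))"
    by (intro recursive_rec_nat recursive_add recursive_const recursive_var) auto
  ultimately show "recursive_fn 2 (\<lambda>e. e 0 * e 1)" by simp
qed

lemma recursive_power: "recursive_fn k a \<Longrightarrow> recursive_fn k b \<Longrightarrow> recursive_fn k (\<lambda>e. a e ^ b e)"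
proof (rule recursive_compose2[of "(^)"])
  have "rec_nat 1 (\<lambda>i z. x * z) y = x ^ y" for x y :: nat by (induction y) auto
  moreover have "recursive_fn 2 (\<lambda>e. rec_nat 1 (\<lambda>i z. e 0 * z) (e 1))"
    by (intro recursive_rec_nat recursive_mult recursive_const recursive_var) auto
  ultimately show "recursive_fn 2 (\<lambda>e. e 0 ^ e 1)" by simp
qed

lemma recursive_diff: "recursive_fn k a \<Longrightarrow> recursive_fn k b \<Longrightarrow> recursive_fn k (\<lambda>e. a e - b e)"
proof (rule recursive_compose2[of "(-)"])
  have "rec_nat 0 (\<lambda>i z. i) x = x - 1" for x by (induction x) auto
  moreover have "recursive_fn 1 (\<lambda>e. rec_nat 0 (\<lambda>i z. i) (e 0))"
    by (intro recursive_rec_nat recursive_const recursive_var) auto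
  ultimately have pred: "recursive_fn 1 (\<lambda>e. e 0 - 1)" by simp
  have "rec_nat x (\<lambda>i z. z - 1) y = x - y" for x y :: nat by (induction y) auto
  moreover have "recursive_fn 2 (\<lambda>e. rec_nat (e 0) (\<lambda>i z. z - 1) (e 1))"
    by (intro recursive_rec_nat recursive_compose1[OF pred] recursive_var) auto
  ultimately show "recursive_fn 2 (\<lambda>e. e 0 - e 1)" by simp
qed

lemma recursive_sum:
  assumes n: "recursive_fn k n" and f: "recursive_fn (Suc k) (\<lambda>e. f (e 0) (\<lambda>j. e (Suc j)))"
  shows "recursive_fn k (\<lambda>e. \<Sum>i<n e. f i e)"
proof -
  have 1: "rec_nat 0 (\<lambda>i z. z + f i e) m = (\<Sum>i<m. f i e)" for m e
    by (induction m) auto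
  obtain p where p: "\<And>e. evals p (map e [0..<Suc k]) (f (e 0) (\<lambda>j. e (Suc j)))"
    using f unfolding recursive_fn_def by blast
  have p': "evals p (i # map e [0..<k]) (f i e)" for i e
    using p[of "case_nat i e"] unfolding map_case_nat_upt by simp
  \<comment> \<open>During the recursion the accumulator stands between the index and the
    environment, while \<open>p\<close> has no place for it. Composing with projections skips
    it.\<close>
  have "recursive_fn (Suc (Suc k)) (\<lambda>e. f (e 0) (\<lambda>j. e (Suc (Suc j))))"
    unfolding recursive_fn_def
  proof (intro exI allI)
    fix e :: "nat \<Rightarrow> nat"
    have P: "evals (Proj i) (map e [0..<Suc (Suc k)]) (e i)" if "i < Suc (Suc k)" for i
      using evals.Proj[of i "map e [0..<Suc (Suc k)]"] that by (simp del: upt_Suc)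
    show "evals (Comp p (Proj 0 # map (\<lambda>i. Proj (Suc (Suc i))) [0..<k])) (map e [0..<Suc (Suc k)])
        (f (e 0) (\<lambda>j. e (Suc (Suc j))))"
    proof (rule evals.Comp)
      show "evals p (e 0 # map (\<lambda>j. e (Suc (Suc j))) [0..<k]) (f (e 0) (\<lambda>j. e (Suc (Suc j))))"
        by (rule p')
      show "list_all2 (\<lambda>g y. evals g (map e [0..<Suc (Suc k)]) y)
         (Proj 0 # map (\<lambda>i. Proj (Suc (Suc i))) [0..<k]) (e 0 # map (\<lambda>j. e (Suc (Suc j))) [0..<k])"
        by (auto simp: list_all2_conv_all_nth nth_Cons simp del: upt_Suc split: nat.split intro: P)
    qed
  qed
  then have "recursive_fn k (\<lambda>e. rec_nat 0 (\<lambda>i z. z + f i e) (n e))"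
    by (intro recursive_rec_nat n recursive_const recursive_add recursive_var) auto
  then show ?thesis by (simp add: 1)
qed

section \<open>Decidable predicates and bounded quantifiers\<close>

lemma decidable_less: "recursive_fn k a \<Longrightarrow> recursive_fn k b \<Longrightarrow> decidable k (\<lambda>e. a e < b e)"
proof -
  assume "recursive_fn k a" "recursive_fn k b"
  \<comment> \<open>Subtraction is truncated, so \<open>Suc (a e) - b e\<close> vanishes exactly
    when \<open>a e < b e\<close>.\<close>
  then have "recursive_fn k (\<lambda>e. 1 - (Suc (a e) - b e))"
    by (intro recursive_diff recursive_const recursive_Suc)
  moreover have "1 - (Suc (a e) - b e) = of_bool (a e < b e)" for e by auto
  ultimately show ?thesis by (simp add: decidable_def)
qed

lemma decidable_not: "decidable k P \<Longrightarrow> decidable k (\<lambda>e. \<not> P e)"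
proof -
  assume "decidable k P"
  then have "recursive_fn k (\<lambda>e. 1 - of_bool (P e))"
    by (intro recursive_diff recursive_const) (simp add: decidable_def)
  moreover have "1 - of_bool (P e) = (of_bool (\<not> P e) :: nat)" for e by simp
  ultimately show ?thesis by (simp add: decidable_def)
qed

lemma decidable_conj: "decidable k P \<Longrightarrow> decidable k Q \<Longrightarrow> decidable k (\<lambda>e. P e \<and> Q e)"
  using recursive_mult[of k "\<lambda>e. of_bool (P e)" "\<lambda>e. of_bool (Q e)"]
  by (simp add: decidable_def of_bool_conj)

lemma decidable_disj: "decidable k P \<Longrightarrow> decidable k Q \<Longrightarrow> decidable k (\<lambda>e. P e \<or> Q e)"
  using decidable_not[OF decidable_conj[OF decidable_not decidable_not, of k P Q]] by simp

lemma decidable_imp: "decidable k P \<Longrightarrow> decidable k Q \<Longrightarrow> decidable k (\<lambda>e. P e \<longrightarrow> Q e)"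
  unfolding imp_conv_disj by (intro decidable_disj decidable_not)

lemma decidable_iff: "decidable k P \<Longrightarrow> decidable k Q \<Longrightarrow> decidable k (\<lambda>e. P e \<longleftrightarrow> Q e)"
  unfolding iff_conv_conj_imp by (intro decidable_conj decidable_imp)

lemma decidable_le: "recursive_fn k a \<Longrightarrow> recursive_fn k b \<Longrightarrow> decidable k (\<lambda>e. a e \<le> b e)"
  using decidable_not[OF decidable_less, of k b a] by (simp add: not_less)

lemma decidable_eq: "recursive_fn k a \<Longrightarrow> recursive_fn k b \<Longrightarrow> decidable k (\<lambda>e. a e = b e)"
  using decidable_conj[OF decidable_le decidable_le, of k a b b a] by (simp add: eq_iff)

lemma decidable_bex:
  assumes "recursive_fn k n" "decidable (Suc k) (\<lambda>e. P (e 0) (\<lambda>j. e (Suc j)))"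
  shows "decidable k (\<lambda>e. \<exists>i<n e. P i e)"
proof -
  have "decidable k (\<lambda>e. 0 < (\<Sum>i<n e. of_bool (P i e) :: nat))"
    using assms by (intro decidable_less recursive_const recursive_sum) (auto simp: decidable_def)
  moreover have "0 < (\<Sum>i<n e. of_bool (P i e) :: nat) \<longleftrightarrow> (\<exists>i<n e. P i e)" for e
    by (auto simp: sum_eq_0_iff simp flip: neq0_conv)
  ultimately show ?thesis by simp
qed

lemma decidable_ball:
  assumes "recursive_fn k n" "decidable (Suc k) (\<lambda>e. P (e 0) (\<lambda>j. e (Suc j)))"
  shows "decidable k (\<lambda>e. \<forall>i<n e. P i e)"
  using decidable_not[OF decidable_bex[OF assms(1) decidable_not[OF assms(2)]]] by simp

lemma recursive_of_bool: "decidable k P \<Longrightarrow> recursive_fn k (\<lambda>e. of_bool (P e))"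
  by (simp add: decidable_def)

lemmas recursive_arith = recursive_const recursive_var recursive_Suc recursive_add recursive_mult
  recursive_power recursive_diff recursive_sum recursive_of_bool decidable_less decidable_le
  decidable_eq decidable_not decidable_conj decidable_disj decidable_imp decidable_iff
  decidable_bex decidable_ball

text \<open>The quotient counts the positive multiples of the divisor up to the dividend. The
  conjunct \<open>0 < d\<close> gives the library value 0 for division by 0.\<close>

lemma recursive_div: "recursive_fn k a \<Longrightarrow> recursive_fn k b \<Longrightarrow> recursive_fn k (\<lambda>e. a e div b e)"
proof (rule recursive_compose2[of "(div)"])
  have "(\<Sum>i<m. of_bool (0 < d \<and> Suc i * d \<le> m)) = m div d" for m d :: nat
  proof (cases "d = 0")
    case False
    have "{i. i < m \<and> 0 < d \<and> Suc i * d \<le> m} = {..<m div d}"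
    proof (intro set_eqI)
      fix i
      have "Suc i * d \<le> m \<longleftrightarrow> i < m div d"
        using False by (simp add: less_eq_div_iff_mult_less_eq flip: Suc_le_eq)
      moreover have "m div d \<le> m" by simp
      ultimately show "i \<in> {i. i < m \<and> 0 < d \<and> Suc i * d \<le> m} \<longleftrightarrow> i \<in> {..<m div d}"
        using False by (metis (mono_tags, lifting) lessThan_iff mem_Collect_eq neq0_conv order_less_le_trans)
    qed
    then show ?thesis by (simp add: sum_of_bool_eq Int_def)
  qed simp
  moreover have "recursive_fn 2 (\<lambda>e. \<Sum>i<e 0. of_bool (0 < e 1 \<and> Suc i * e 1 \<le> e 0))"
    by (intro recursive_arith) auto
  ultimately show "recursive_fn 2 (\<lambda>e. e 0 div e 1)" by simp
qed

lemma recursive_mod: "recursive_fn k a \<Longrightarrow> recursive_fn k b \<Longrightarrow> recursive_fn k (\<lambda>e. a e mod b e)"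
  unfolding modulo_nat_def by (intro recursive_diff recursive_mult recursive_div)

lemma decidable_mem_set_decode:
  "recursive_fn k a \<Longrightarrow> recursive_fn k b \<Longrightarrow> decidable k (\<lambda>e. a e \<in> set_decode (b e))"
  unfolding set_decode_def mem_Collect_eq odd_iff_mod_2_eq_one
  by (intro recursive_arith recursive_div recursive_mod)

section \<open>Codes of lists\<close>

definition tl_code :: "nat \<Rightarrow> nat" where
  "tl_code c = list_encode (tl (list_decode c))"

definition hd_code :: "nat \<Rightarrow> nat" where
  "hd_code c = (case list_decode c of [] \<Rightarrow> 0 | x # xs \<Rightarrow> x)"

lemma prod_encode_arith: "prod_encode (x, y) = (x + y) * Suc (x + y) div 2 + x"
  by (simp add: prod_encode_def triangle_def)

text \<open>The code of a nonempty list is the successor of the code of a unique pair whose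
  components lie below it. So in each sum a single indicator is true and picks out the component;
  for the empty list, coded by 0, the sums are empty.\<close>

lemma list_code_components:
  "hd_code c = (\<Sum>x<c. x * of_bool (\<exists>y<c. Suc ((x + y) * Suc (x + y) div 2 + x) = c))"
  "tl_code c = (\<Sum>y<c. y * of_bool (\<exists>x<c. Suc ((x + y) * Suc (x + y) div 2 + x) = c))"
proof -
  have "hd_code c = (\<Sum>x<c. x * of_bool (\<exists>y<c. Suc (prod_encode (x, y)) = c)) \<and>
        tl_code c = (\<Sum>y<c. y * of_bool (\<exists>x<c. Suc (prod_encode (x, y)) = c))"
  proof (cases "list_decode c")
    case Nil
    then have "c = 0" by (metis list_decode_inverse list_encode.simps(1))
    then show ?thesis using Nil by (simp add: hd_code_def tl_code_def)
  next
    case (Cons h t)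
    define s where "s = list_encode t"
    have c: "c = Suc (prod_encode (h, s))"
      using Cons by (metis s_def list_decode_inverse list_encode.simps(2))
    then have lt: "h < c" "s < c"
      using le_prod_encode_1[of h s] le_prod_encode_2[of s h] by auto
    have 1: "(\<exists>y<c. Suc (prod_encode (x, y)) = c) \<longleftrightarrow> x = h" for x
      using lt by (auto simp: c prod_encode_eq)
    have 2: "(\<exists>x<c. Suc (prod_encode (x, y)) = c) \<longleftrightarrow> y = s" for y
      using lt by (auto simp: c prod_encode_eq)
    have "hd_code c = h" "tl_code c = s" using Cons by (simp_all add: hd_code_def tl_code_def s_def)
    then show ?thesis using lt by (simp add: 1 2 of_bool_def if_distrib cong: if_cong)
  qed
  then show "hd_code c = (\<Sum>x<c. x * of_bool (\<exists>y<c. Suc ((x + y) * Suc (x + y) div 2 + x) = c))"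
    "tl_code c = (\<Sum>y<c. y * of_bool (\<exists>x<c. Suc ((x + y) * Suc (x + y) div 2 + x) = c))"
    by (simp_all only: prod_encode_arith)
qed

lemma recursive_hd_code: "recursive_fn k a \<Longrightarrow> recursive_fn k (\<lambda>e. hd_code (a e))"
  by (rule recursive_compose1[of hd_code], unfold list_code_components)
    (intro recursive_arith recursive_div; simp)

lemma recursive_tl_code: "recursive_fn k a \<Longrightarrow> recursive_fn k (\<lambda>e. tl_code (a e))"
  by (rule recursive_compose1[of tl_code], unfold list_code_components)
    (intro recursive_arith recursive_div; simp)

lemma list_decode_iterate_tl: "list_decode (rec_nat c (\<lambda>i. tl_code) j) = drop j (list_decode c)"
  by (induction j) (auto simp: tl_code_def drop_Suc tl_drop)

lemma length_le_list_encode: "length xs \<le> list_encode xs"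
proof (induction xs)
  case (Cons x xs)
  then show ?case using le_prod_encode_2[of "list_encode xs" x] by simp
qed simp

text \<open>The default 0 is the value of \<open>hd_code\<close> at the empty list, so that the
  equation with the head of an iterated tail holds past the end as well.\<close>

definition code_nth :: "nat \<Rightarrow> nat \<Rightarrow> nat" where
  "code_nth c j = (if j < length (list_decode c) then list_decode c ! j else 0)"

lemma recursive_code_nth:
  "recursive_fn k a \<Longrightarrow> recursive_fn k b \<Longrightarrow> recursive_fn k (\<lambda>e. code_nth (a e) (b e))"
proof (rule recursive_compose2[of "code_nth"])
  have "hd_code (rec_nat c (\<lambda>i. tl_code) j) = code_nth c j" for c j
    by (cases "j < length (list_decode c)")
      (simp_all add: hd_code_def code_nth_def list_decode_iterate_tl flip: Cons_nth_drop_Suc)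
  moreover have "recursive_fn 2 (\<lambda>e. hd_code (rec_nat (e 0) (\<lambda>i. tl_code) (e 1)))"
    by (intro recursive_hd_code recursive_rec_nat recursive_tl_code recursive_var) auto
  ultimately show "recursive_fn 2 (\<lambda>e. code_nth (e 0) (e 1))" by simp
qed

text \<open>The length is the number of iterated tails that are nonempty, that is, have a nonzero
  code. As a list is no longer than its code, counting up to the code finds them all.\<close>

lemma recursive_code_length:
  "recursive_fn k a \<Longrightarrow> recursive_fn k (\<lambda>e. length (list_decode (a e)))"
proof (rule recursive_compose1[of "\<lambda>c. length (list_decode c)"])
  have "rec_nat c (\<lambda>i. tl_code) j \<noteq> 0 \<longleftrightarrow> j < length (list_decode c)" for c j
    by (metis drop_eq_Nil linorder_not_le list_decode.simps(1) list_decode_eq list_decode_iterate_tl)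
  moreover have "{j. j < c \<and> j < length (list_decode c)} = {..<length (list_decode c)}" for c
    using length_le_list_encode[of "list_decode c"] by auto
  ultimately have "(\<Sum>j<c. of_bool (rec_nat c (\<lambda>i. tl_code) j \<noteq> 0)) = length (list_decode c)" for c
    by (simp add: sum_of_bool_eq Int_def)
  moreover have "recursive_fn 1 (\<lambda>e. \<Sum>j<e 0. of_bool (rec_nat (e 0) (\<lambda>i. tl_code) j \<noteq> 0))"
    by (intro recursive_arith recursive_rec_nat recursive_tl_code) auto
  ultimately show "recursive_fn 1 (\<lambda>e. length (list_decode (e 0)))" by simp
qed

section \<open>Windows and block correspondences\<close>

definition shift :: "int \<Rightarrow> 'a biword \<Rightarrow> 'a biword" where
  "shift k x = (\<lambda>i. x (i + k))"

lemma full_shift_letter: "X \<subseteq> full_shift A \<Longrightarrow> x \<in> X \<Longrightarrow> x i \<in> A"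
  unfolding full_shift_def by blast

definition agree :: "nat \<Rightarrow> 'a biword \<Rightarrow> 'a biword \<Rightarrow> bool" where
  "agree n x y \<longleftrightarrow> (\<forall>j<n. x (int j) = y (int j))"

definition shift_invariant :: "'a biword set \<Rightarrow> bool" where
  "shift_invariant X \<longleftrightarrow> (\<forall>x\<in>X. \<forall>k. shift k x \<in> X)"

text \<open>This is the property of an \<open>n\<close>-step shift: a past and a future sharing a
  window of length \<open>n\<close> can be joined along it.\<close>

definition gluing :: "nat \<Rightarrow> 'a biword set \<Rightarrow> bool" where
  "gluing n X \<longleftrightarrow> (\<forall>x\<in>X. \<forall>x'\<in>X. agree n x x' \<longrightarrow> (\<lambda>i. if i < int n then x i else x' i) \<in> X)"

text \<open>A relation treats both sides alike and can stay fixed while the window lengths vary.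
  Since it is compatible with shifts, comparing windows at position 0 amounts to comparing them at
  all positions.\<close>

definition block_corr ::
  "nat \<Rightarrow> nat \<Rightarrow> 'a biword set \<Rightarrow> 'b biword set \<Rightarrow> ('a biword \<Rightarrow> 'b biword \<Rightarrow> bool) \<Rightarrow> bool" where
  "block_corr M N X Y R \<longleftrightarrow>
     (\<forall>x y. R x y \<longrightarrow> x \<in> X \<and> y \<in> Y) \<and> (\<forall>x\<in>X. \<exists>y. R x y) \<and> (\<forall>y\<in>Y. \<exists>x. R x y) \<and>
     (\<forall>x y k. R x y \<longrightarrow> R (shift k x) (shift k y)) \<and>
     (\<forall>x y x' y'. R x y \<longrightarrow> R x' y' \<longrightarrow> agree M x x' \<longleftrightarrow> agree N y y')"

lemma block_corr_memberD: "block_corr M N X Y R \<Longrightarrow> R x y \<Longrightarrow> x \<in> X \<and> y \<in> Y"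
  unfolding block_corr_def by simp

lemma block_corr_shiftD: "block_corr M N X Y R \<Longrightarrow> R x y \<Longrightarrow> R (shift k x) (shift k y)"
  unfolding block_corr_def by simp

lemma block_corr_agreeD:
  "block_corr M N X Y R \<Longrightarrow> R x y \<Longrightarrow> R x' y' \<Longrightarrow> agree M x x' \<longleftrightarrow> agree N y y'"
  unfolding block_corr_def by simp

lemma block_corr_change_windows:
  assumes "block_corr M N X Y R"
    and "\<And>x y x' y'. R x y \<Longrightarrow> R x' y' \<Longrightarrow> agree M' x x' \<longleftrightarrow> agree N' y y'"
  shows "block_corr M' N' X Y R"
  using assms unfolding block_corr_def by simp

lemma block_corr_sym: "block_corr M N X Y R \<Longrightarrow> block_corr N M Y X (\<lambda>y x. R x y)"
  unfolding block_corr_def by blast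

section \<open>Changing the window lengths\<close>

lemma agree_sym: "agree n x y \<longleftrightarrow> agree n y x"
  by (auto simp: agree_def)

lemma agree_trans: "agree n x y \<Longrightarrow> agree n y z \<Longrightarrow> agree n x z"
  by (simp add: agree_def)

lemma agree_mono: "agree n x y \<Longrightarrow> m \<le> n \<Longrightarrow> agree m x y"
  by (simp add: agree_def)

lemma agree_Suc: "agree (Suc n) x y \<longleftrightarrow> x 0 = y 0 \<and> agree n (shift 1 x) (shift 1 y)"
  unfolding agree_def shift_def by (subst All_less_Suc2) (simp add: add.commute)

lemma agree_Suc_iff:
  assumes "n \<ge> 1"
  shows "agree (Suc n) x y \<longleftrightarrow> agree n x y \<and> agree n (shift 1 x) (shift 1 y)"
proof -
  obtain m where "n = Suc m" using assms by (cases n) auto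
  then show ?thesis using agree_Suc[of n x y] agree_Suc[of m x y] agree_mono[of "Suc n" x y n] by auto
qed

text \<open>For positive lengths, a window that is one letter longer is the union of two consecutive
  windows of the old length, and the shifted words are again related.\<close>

lemma block_corr_Suc:
  assumes R: "block_corr M N X Y R" and "M \<ge> 1" "N \<ge> 1"
  shows "block_corr (Suc M) (Suc N) X Y R"
proof -
  have "agree (Suc M) x x' \<longleftrightarrow> agree (Suc N) y y'" if "R x y" "R x' y'" for x y x' y'
  proof -
    have "R (shift 1 x) (shift 1 y)" "R (shift 1 x') (shift 1 y')"
      using R that by (auto intro: block_corr_shiftD)
    then show ?thesis
      using assms(2,3) that block_corr_agreeD[OF R] by (simp add: agree_Suc_iff)
  qed
  then show ?thesis by (rule block_corr_change_windows[OF R])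
qed

lemma block_corr_add:
  assumes "block_corr M N X Y R" "M \<ge> 1" "N \<ge> 1"
  shows "block_corr (M + k) (N + k) X Y R"
  using assms by (induction k) (auto intro: block_corr_Suc)

text \<open>Words that agree on a window of length \<open>M\<close> are compared through the word that follows the
  first one up to the window and the second one from the window on.\<close>

lemma agree_descent:
  assumes R: "block_corr (Suc M) (Suc N) X Y R" and X: "gluing M X"
    and xy: "R x y" "R x' y'" and agr: "agree M x x'"
  shows "agree N y y'"
proof -
  define z where "z = (\<lambda>i. if i < int M then x i else x' i)"
  have "x \<in> X" "x' \<in> X" using R xy by (auto simp: block_corr_def)
  then have "z \<in> X" using X agr by (simp add: gluing_def z_def)
  then obtain w where w: "R z w" using R by (auto simp: block_corr_def)
  \<comment> \<open>Shifting by -1 exposes the window \<open>[-1, M)\<close>, on which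
    \<open>z\<close> coincides with \<open>x\<close>; hence \<open>w\<close> and \<open>y\<close>
    agree on \<open>[-1, N)\<close>.\<close>
  have sh: "R (shift (-1) x) (shift (-1) y)" "R (shift (-1) z) (shift (-1) w)"
    using R xy w by (auto simp: block_corr_def)
  have "agree (Suc M) (shift (-1) z) (shift (-1) x)"
    by (auto simp: agree_def shift_def z_def)
  then have "agree (Suc N) (shift (-1) w) (shift (-1) y)"
    using R sh unfolding block_corr_def by blast
  then have "agree N w y" by (simp add: agree_Suc shift_def)
  \<comment> \<open>On \<open>[0, M]\<close> the word \<open>z\<close> coincides with
    \<open>x'\<close>: below \<open>M\<close> because \<open>x\<close> and \<open>x'\<close> share
    that window, at \<open>M\<close> by construction.\<close>
  moreover have "agree (Suc M) z x'"
    using agr by (auto simp: agree_def z_def)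
  then have "agree (Suc N) w y'" using R w xy unfolding block_corr_def by blast
  then have "agree N w y'" by (rule agree_mono) simp
  ultimately show ?thesis using agree_trans agree_sym by blast
qed

lemma block_corr_descent:
  assumes R: "block_corr (Suc M) (Suc N) X Y R" and X: "gluing M X" and Y: "gluing N Y"
  shows "block_corr M N X Y R"
  using agree_descent[OF R X] agree_descent[OF block_corr_sym[OF R] Y]
  by (intro block_corr_change_windows[OF R]) blast

text \<open>Both lengths decrease together, so the descent ends as soon as one of them reaches
  \<open>m\<close>.\<close>

lemma block_corr_descent_to_corner:
  assumes "block_corr (m + i) (m + j) X Y R"
    and "\<And>n. n \<ge> m \<Longrightarrow> gluing n X" "\<And>n. n \<ge> m \<Longrightarrow> gluing n Y"
  shows "\<exists>i' j'. block_corr (m + i') (m + j') X Y R \<and> (i' = 0 \<or> j' = 0)"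
  using assms(1)
proof (induction i arbitrary: j)
  case 0
  then show ?case by blast
next
  case (Suc i)
  show ?case
  proof (cases j)
    case 0
    then show ?thesis using Suc.prems by blast
  next
    case (Suc j')
    then show ?thesis
      using Suc.IH[of j'] Suc.prems block_corr_descent[of "m + i" "m + j'" X Y R] assms(2,3) by simp
  qed
qed

section \<open>Windows as numbers in base \<open>q\<close>\<close>

fun word_num :: "nat \<Rightarrow> nat \<Rightarrow> nat biword \<Rightarrow> int \<Rightarrow> nat" where
  "word_num q 0 x i = 0"
| "word_num q (Suc n) x i = x i + q * word_num q n x (i + 1)"

definition digit :: "nat \<Rightarrow> nat \<Rightarrow> nat \<Rightarrow> nat" where
  "digit q w i = w div q ^ i mod q"

lemma digit_0 [simp]: "digit q w 0 = w mod q"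
  by (simp add: digit_def)

lemma digit_Suc [simp]: "digit q w (Suc i) = digit q (w div q) i"
  by (simp add: digit_def div_mult2_eq)

lemma digit_mod_power:
  assumes "q > 0" "i < n"
  shows "digit q (w mod q ^ n) i = digit q w i"
proof -
  obtain k where n: "n = i + Suc k" using assms(2) less_imp_Suc_add by auto
  have "w mod (q ^ i * q ^ Suc k) div q ^ i = w div q ^ i mod q ^ Suc k"
    unfolding mod_mult2_eq[of w] using assms(1) by simp
  then show ?thesis unfolding digit_def n power_add by (simp add: mod_mod_cancel)
qed

text \<open>Numbers below \<open>q ^ n\<close> are thus tables of maps from \<open>{..<n}\<close> to
  \<open>{..<q}\<close>. Sets of words (with base 2) and block maps are coded in this way, which
  makes the search for them a bounded quantifier.\<close>

lemma exists_digits: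
  assumes "\<And>i. i < n \<Longrightarrow> h i < q"
  shows "\<exists>w<q ^ n. \<forall>i<n. digit q w i = h i"
  using assms
proof (induction n arbitrary: h)
  case (Suc n)
  obtain w where w: "w < q ^ n" "\<forall>i<n. digit q w i = h (Suc i)"
    using Suc.IH[of "\<lambda>i. h (Suc i)"] Suc.prems by auto
  have h0: "h 0 < q" using Suc.prems by simp
  have "h 0 + q * w < q * Suc w" using h0 by simp
  also have "\<dots> \<le> q * q ^ n" using w(1) by (intro mult_le_mono2) simp
  finally have "h 0 + q * w < q ^ Suc n" by simp
  moreover have "digit q (h 0 + q * w) i = h i" if "i < Suc n" for i
    using that w(2) h0 by (cases i) auto
  ultimately show ?case by blast
qed simp

lemma digits_inject:
  "\<lbrakk>v < q ^ n; w < q ^ n; \<And>i. i < n \<Longrightarrow> digit q v i = digit q w i\<rbrakk> \<Longrightarrow> v = w"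
proof (induction n arbitrary: v w)
  case (Suc n)
  have "v div q = w div q"
  proof (rule Suc.IH)
    show "v div q < q ^ n" "w div q < q ^ n"
      using Suc.prems(1,2) by (simp_all add: less_mult_imp_div_less mult.commute)
    show "digit q (v div q) i = digit q (w div q) i" if "i < n" for i
      using Suc.prems(3)[of "Suc i"] that by simp
  qed
  moreover have "v mod q = w mod q" using Suc.prems(3)[of 0] by simp
  ultimately show ?case by (metis mult_div_mod_eq)
qed simp

lemma word_num_digit:
  assumes "\<And>i. x i < q"
  shows "j < n \<Longrightarrow> digit q (word_num q n x i) j = x (i + int j)"
proof (induction n arbitrary: i j)
  case (Suc n)
  have "q > 0" using assms[of 0] by simp
  then show ?case using Suc assms[of i] by (cases j) (auto simp: add.assoc)
qed simp

lemma word_num_less: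
  assumes "\<And>i. x i < q"
  shows "word_num q n x i < q ^ n"
proof (induction n arbitrary: i)
  case (Suc n)
  have "x i + q * word_num q n x (i + 1) < q * Suc (word_num q n x (i + 1))" using assms[of i] by simp
  also have "\<dots> \<le> q * q ^ n" using Suc[of "i + 1"] by (intro mult_le_mono2) simp
  finally show ?case by simp
qed simp

lemma word_num_eqI:
  assumes "\<And>i. x i < q" "w < q ^ n" "\<And>j. j < n \<Longrightarrow> digit q w j = x (i + int j)"
  shows "w = word_num q n x i"
proof (rule digits_inject[OF assms(2) word_num_less[of x q, OF assms(1)]])
  show "digit q w j = digit q (word_num q n x i) j" if "j < n" for j
    unfolding assms(3)[OF that] word_num_digit[of x q, OF assms(1) that] ..
qed

lemma word_num_Suc_mod:
  assumes "\<And>i. x i < q"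
  shows "word_num q (Suc n) x i mod q ^ n = word_num q n x i"
proof (rule word_num_eqI[OF assms])
  have "0 < q" using assms[of 0] by simp
  then show "word_num q (Suc n) x i mod q ^ n < q ^ n" by simp
  from \<open>0 < q\<close> show "digit q (word_num q (Suc n) x i mod q ^ n) j = x (i + int j)" if "j < n" for j
    using that by (simp add: digit_mod_power word_num_digit[OF assms] del: word_num.simps)
qed

lemma word_num_Suc_div:
  assumes "\<And>i. x i < q"
  shows "word_num q (Suc n) x i div q = word_num q n x (i + 1)"
  using assms[of i] by simp

lemma word_num_eq_iff:
  assumes "\<And>i. x i < q" "\<And>i. y i < q"
  shows "word_num q n x i = word_num q n y j \<longleftrightarrow> (\<forall>t<n. x (i + int t) = y (j + int t))"
proof
  assume eq: "word_num q n x i = word_num q n y j"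
  show "\<forall>t<n. x (i + int t) = y (j + int t)"
  proof (intro allI impI)
    fix t assume "t < n"
    then show "x (i + int t) = y (j + int t)"
      using word_num_digit[of x q t n i, OF assms(1)] word_num_digit[of y q t n j, OF assms(2)] eq
      by simp
  qed
next
  assume eq: "\<forall>t<n. x (i + int t) = y (j + int t)"
  show "word_num q n x i = word_num q n y j"
  proof (rule word_num_eqI[of y q, OF assms(2) word_num_less[of x q, OF assms(1)]])
    show "digit q (word_num q n x i) t = y (j + int t)" if "t < n" for t
      using word_num_digit[of x q t n i, OF assms(1) that] eq that by simp
  qed
qed

lemma word_num_shift: "word_num q n (shift k x) i = word_num q n x (i + k)"
  by (induction n arbitrary: i) (simp_all add: shift_def algebra_simps)

declare word_num.simps(2) [simp del]

lemma agree_iff_word_num: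
  assumes "\<And>i. x i < q" "\<And>i. y i < q"
  shows "agree n x y \<longleftrightarrow> word_num q n x 0 = word_num q n y 0"
  by (simp add: word_num_eq_iff[OF assms] agree_def)

text \<open>A bi-infinite path in the de Bruijn graph spells a word: moving along the overlap
  \<open>j\<close> times shows that digit \<open>j\<close> of \<open>V i\<close> is the lowest digit
  of \<open>V (i + j)\<close>.\<close>

lemma word_num_path:
  assumes q: "q > 0" and V: "\<And>i. V i < q ^ Suc n" "\<And>i. V i div q = V (i + 1) mod q ^ n"
  shows "word_num q (Suc n) (\<lambda>i. V i mod q) i = V i"
proof -
  have d: "digit q (V i) j = V (i + int j) mod q" if "j \<le> n" for i j
    using that
  proof (induction j arbitrary: i)
    case (Suc j)
    have "digit q (V i) (Suc j) = digit q (V (i + 1)) j"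
      using Suc.prems by (simp add: V(2) digit_mod_power q)
    also have "\<dots> = V (i + int (Suc j)) mod q"
      using Suc by (simp add: add.assoc)
    finally show ?case .
  qed simp
  show ?thesis
    using q V(1) d by (intro word_num_eqI[symmetric]) auto
qed

section \<open>From similarity to a block correspondence\<close>

lemma block_code_eq_iff:
  "block_code n x i = block_code n y j \<longleftrightarrow> (\<forall>t<n. x (i + int t) = y (j + int t))"
  by (auto simp: block_code_def)

text \<open>The two projections need not be inverse to each other. But each maps the blocks
  occurring on one side onto those occurring on the other, and by finiteness \<phi> is injective on
  the occurring blocks. The correspondence relates \<open>x\<close> to \<open>y\<close> when \<phi>
  takes the block code of \<open>x\<close> to that of \<open>y\<close>.\<close>

lemma similar_imp_block_corr:
  assumes fin: "finite A" and X: "X \<subseteq> full_shift A" "shift_invariant X" and Y: "shift_invariant Y"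
    and sim: "similar (block_alphabet M A) (block_presentation M X)
       (block_alphabet N B) (block_presentation N Y)"
  shows "\<exists>R. block_corr M N X Y R"
proof -
  obtain \<phi> \<psi> where \<phi>: "(\<lambda>u. \<phi> \<circ> u) ` block_presentation M X = block_presentation N Y"
    and \<psi>: "(\<lambda>u. \<psi> \<circ> u) ` block_presentation N Y = block_presentation M X"
    using sim unfolding similar_def projects_onto_def by (elim conjE exE) (erule that)
  define P where "P = (\<Union>x\<in>X. range (block_code M x))"
  define P' where "P' = (\<Union>y\<in>Y. range (block_code N y))"
  have to: "\<exists>y\<in>Y. block_code N y = \<phi> \<circ> block_code M x" if "x \<in> X" for x
  proof -
    have "\<phi> \<circ> block_code M x \<in> (\<lambda>u. \<phi> \<circ> u) ` block_code M ` X"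
      using that by (intro imageI)
    then have "\<phi> \<circ> block_code M x \<in> block_code N ` Y"
      using \<phi> by (simp only: block_presentation_def)
    then obtain y where "\<phi> \<circ> block_code M x = block_code N y" "y \<in> Y" by (rule imageE)
    then show ?thesis by (intro bexI[of _ y]) simp
  qed
  have onto: "\<exists>x\<in>X. block_code N y = \<phi> \<circ> block_code M x" if "y \<in> Y" for y
  proof -
    have "block_code N y \<in> (\<lambda>u. \<phi> \<circ> u) ` block_code M ` X"
      using that \<phi> by (simp add: block_presentation_def)
    then obtain x where "block_code N y = \<phi> \<circ> block_code M x" "x \<in> X" by (elim imageE) simp
    then show ?thesis by (rule bexI)
  qed
  have onto': "\<exists>y\<in>Y. block_code M x = \<psi> \<circ> block_code N y" if "x \<in> X" for x
  proof -
    have "block_code M x \<in> (\<lambda>u. \<psi> \<circ> u) ` block_code N ` Y"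
      using that \<psi> by (simp add: block_presentation_def)
    then obtain y where "block_code M x = \<psi> \<circ> block_code N y" "y \<in> Y" by (elim imageE) simp
    then show ?thesis by (rule bexI)
  qed
  have P1: "\<phi> ` P = P'"
  proof (intro equalityI subsetI)
    fix b assume "b \<in> \<phi> ` P"
    then obtain x i where x: "x \<in> X" "b = \<phi> (block_code M x i)" by (auto simp: P_def)
    obtain y where y: "y \<in> Y" "block_code N y = \<phi> \<circ> block_code M x" using to[OF x(1)] by blast
    have "b = block_code N y i" by (simp add: y(2) x(2))
    then show "b \<in> P'" using y(1) by (auto simp: P'_def)
  next
    fix b assume "b \<in> P'"
    then obtain y i where y: "y \<in> Y" "b = block_code N y i" by (auto simp: P'_def)
    obtain x where x: "x \<in> X" "block_code N y = \<phi> \<circ> block_code M x" using onto[OF y(1)] by blast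
    have "block_code M x i \<in> P" unfolding P_def using x(1) by blast
    then show "b \<in> \<phi> ` P" unfolding y(2) x(2) by simp
  qed
  have P2: "P \<subseteq> \<psi> ` P'"
  proof
    fix b assume "b \<in> P"
    then obtain x i where x: "x \<in> X" "b = block_code M x i" by (auto simp: P_def)
    obtain y where y: "y \<in> Y" "block_code M x = \<psi> \<circ> block_code N y" using onto'[OF x(1)] by blast
    have "block_code N y i \<in> P'" unfolding P'_def using y(1) by blast
    then show "b \<in> \<psi> ` P'" unfolding x(2) y(2) by simp
  qed
  have "P \<subseteq> {w. set w \<subseteq> A \<and> length w = M}"
    using full_shift_letter[OF X(1)] by (auto simp: P_def block_code_def)
  then have finP: "finite P" using finite_lists_length_eq[OF fin] by (rule finite_subset)
  \<comment> \<open>The surjection \<psi> gives this inequality and \<phi> the reverse one, so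
    \<phi> is a surjection between finite sets of equal size.\<close>
  then have "card P \<le> card P'" using P1 P2 by (metis finite_imageI surj_card_le)
  then have inj: "inj_on \<phi> P" using P1 finP by (metis card_image_le eq_card_imp_inj_on le_antisym)
  define R where "R x y \<longleftrightarrow> x \<in> X \<and> y \<in> Y \<and> block_code N y = \<phi> \<circ> block_code M x" for x y
  have sh: "block_code n (shift k x) = (\<lambda>i. block_code n x (i + k))" for n k and x :: "'c biword"
    by (auto simp: block_code_def shift_def algebra_simps)
  have "agree M x x' \<longleftrightarrow> agree N y y'" if "R x y" "R x' y'" for x y x' y'
  proof -
    have "block_code M x 0 \<in> P" "block_code M x' 0 \<in> P" using that unfolding P_def R_def by blast+
    then have "block_code M x 0 = block_code M x' 0 \<longleftrightarrow>
        \<phi> (block_code M x 0) = \<phi> (block_code M x' 0)"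
      using inj by (auto dest: inj_onD)
    also have "\<dots> \<longleftrightarrow> block_code N y 0 = block_code N y' 0"
      using that by (simp add: R_def)
    finally show ?thesis by (simp add: agree_def block_code_eq_iff)
  qed
  moreover have "R (shift k x) (shift k y)" if "R x y" for x y k
    using that X(2) Y by (auto simp: R_def sh shift_invariant_def fun_eq_iff)
  moreover have "\<exists>y. R x y" if "x \<in> X" for x
    using to[OF that] that unfolding R_def by blast
  moreover have "\<exists>x. R x y" if "y \<in> Y" for y
    using onto[OF that] that unfolding R_def by blast
  moreover have "x \<in> X \<and> y \<in> Y" if "R x y" for x y
    using that by (simp add: R_def)
  ultimately have "block_corr M N X Y R"
    unfolding block_corr_def by simp
  then show ?thesis by (intro exI[of _ R])
qed

section \<open>Bounding the longer window by complexity\<close>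

lemma agree_determines_longer:
  assumes Y: "shift_invariant Y"
    and det: "\<And>y y'. \<lbrakk>y \<in> Y; y' \<in> Y; agree n y y'\<rbrakk> \<Longrightarrow> agree (Suc n) y y'"
  shows "\<lbrakk>y \<in> Y; y' \<in> Y; agree n y y'\<rbrakk> \<Longrightarrow> agree (n + k) y y'"
proof (induction k arbitrary: y y')
  case (Suc k)
  have "agree (Suc n) y y'" using det Suc.prems by simp
  \<comment> \<open>The letter after the window is determined too, so the shifted words agree on
    \<open>n\<close> letters and the induction hypothesis applies to them.\<close>
  then have "y 0 = y' 0" "agree n (shift 1 y) (shift 1 y')" by (auto simp: agree_Suc)
  moreover have "shift 1 y \<in> Y" "shift 1 y' \<in> Y" using Y Suc.prems by (auto simp: shift_invariant_def)
  ultimately show ?case using Suc.IH by (simp add: agree_Suc)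
qed simp

definition language :: "nat \<Rightarrow> nat \<Rightarrow> nat biword set \<Rightarrow> nat set" where
  "language q n Y = (\<lambda>y. word_num q n y 0) ` Y"

lemma language_subset: "Y \<subseteq> full_shift {..<q} \<Longrightarrow> language q n Y \<subseteq> {..<q ^ n}"
  by (auto simp: language_def dest: full_shift_letter intro!: word_num_less)

lemma language_card_le:
  assumes "Y \<subseteq> full_shift {..<q}"
  shows "card (language q n Y) \<le> q ^ n"
  using card_mono[OF _ language_subset[OF assms], of n] by simp

lemma language_truncate:
  assumes "Y \<subseteq> full_shift {..<q}"
  shows "(\<lambda>w. w mod q ^ n) ` language q (Suc n) Y = language q n Y"
  unfolding language_def image_image
  using full_shift_letter[OF assms]
  by (intro image_cong refl) (simp add: word_num_Suc_mod)

text \<open>The image of a window is read off from any related pair that shows it. Agreement of the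
  \<open>M\<close>-windows forces agreement of the \<open>N\<close>-windows, so the choice does not
  matter.\<close>

lemma block_corr_code_map:
  assumes R: "block_corr M N X Y R" and X: "X \<subseteq> full_shift {..<q}" and Y: "Y \<subseteq> full_shift {..<q}"
  shows "\<exists>h. \<forall>x y i. R x y \<longrightarrow> h (word_num q M x i) = word_num q N y i"
proof -
  have lt: "x i < q" if "x \<in> X \<union> Y" for x i using that full_shift_letter[OF X] full_shift_letter[OF Y] by auto
  define h where "h v = (SOME w. \<exists>x y. R x y \<and> v = word_num q M x 0 \<and> w = word_num q N y 0)" for v
  have h0: "h (word_num q M x 0) = word_num q N y 0" if "R x y" for x y
    unfolding h_def
  proof (rule some_equality)
    show "\<exists>x' y'. R x' y' \<and> word_num q M x 0 = word_num q M x' 0 \<and>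
        word_num q N y 0 = word_num q N y' 0" using that by blast
  next
    fix w assume "\<exists>x' y'. R x' y' \<and> word_num q M x 0 = word_num q M x' 0 \<and> w = word_num q N y' 0"
    then obtain x' y' where *: "R x' y'" "word_num q M x 0 = word_num q M x' 0" "w = word_num q N y' 0"
      by blast
    have in_XY: "x \<in> X" "y \<in> Y" "x' \<in> X" "y' \<in> Y" using block_corr_memberD[OF R] that *(1) by blast+
    have "agree M x x'" using * in_XY by (subst agree_iff_word_num[of _ q]) (auto simp: lt)
    then have "agree N y y'" using block_corr_agreeD[OF R, OF that *(1)] by simp
    then show "w = word_num q N y 0"
      using in_XY *(3) by (subst (asm) agree_iff_word_num[of _ q]) (auto simp: lt)
  qed
  have "h (word_num q M x i) = word_num q N y i" if "R x y" for x y i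
  proof -
    have "R (shift i x) (shift i y)" by (rule block_corr_shiftD[OF R, OF that])
    from h0[OF this] show ?thesis by (simp add: word_num_shift)
  qed
  then show ?thesis by blast
qed

lemma block_corr_bounded:
  assumes R: "block_corr m N X Y R" and N: "N \<ge> m"
    and X: "X \<subseteq> full_shift {..<q}" and Y: "Y \<subseteq> full_shift {..<q}" "shift_invariant Y"
  shows "\<exists>n. m \<le> n \<and> n \<le> Suc (m + q ^ m) \<and> block_corr m n X Y R"
proof (cases "N \<le> Suc (m + q ^ m)")
  case True
  then show ?thesis using R N by blast
next
  case False
  define c where "c n = card (language q n Y)" for n
  have lt: "x i < q" if "x \<in> X \<union> Y" for x i using that full_shift_letter[OF X] full_shift_letter[OF Y(1)] by auto
  have fin: "finite (language q n Y)" for n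
    using language_subset[OF Y(1)] by (rule finite_subset) simp
  have c_Suc: "c n \<le> c (Suc n)" for n
    using card_image_le[OF fin, of "\<lambda>w. w mod q ^ n" "Suc n"]
    by (simp add: language_truncate[OF Y(1)] c_def)
  have cN: "c N \<le> q ^ m"
  proof -
    obtain g where g: "\<And>x y. R x y \<Longrightarrow> g (word_num q m x 0) = word_num q N y 0"
      using block_corr_code_map[OF R X Y(1)] by blast
    have "language q N Y \<subseteq> g ` language q m X"
    proof
      fix w assume "w \<in> language q N Y"
      then obtain y where y: "y \<in> Y" "w = word_num q N y 0" by (auto simp: language_def)
      then obtain x where x: "R x y" using R by (auto simp: block_corr_def)
      then have "word_num q m x 0 \<in> language q m X"
        using block_corr_memberD[OF R] by (auto simp: language_def)
      then show "w \<in> g ` language q m X" using g[OF x] y(2) by (metis imageI)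
    qed
    moreover have "finite (language q m X)"
      using language_subset[OF X] by (rule finite_subset) simp
    ultimately have "c N \<le> card (language q m X)" unfolding c_def by (metis surj_card_le)
    then show ?thesis using language_card_le[OF X, of m] by simp
  qed
  \<comment> \<open>Strict growth at all \<open>q ^ m + 1\<close> lengths from \<open>m\<close> on
    would push the complexity above \<open>q ^ m\<close> at length \<open>m + q ^ m + 1\<close>,
    which is below \<open>N\<close>.\<close>
  have "\<exists>n. m \<le> n \<and> n < Suc (m + q ^ m) \<and> c n = c (Suc n)"
  proof (rule ccontr)
    assume "\<not> ?thesis"
    then have strict: "c n < c (Suc n)" if "m \<le> n" "n < Suc (m + q ^ m)" for n
      using that c_Suc[of n] by (metis le_neq_implies_less)
    have "k \<le> c (m + k)" if "k \<le> Suc (q ^ m)" for k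
      using that
    proof (induction k)
      case (Suc k)
      then show ?case using strict[of "m + k"] by simp
    qed simp
    from this[of "Suc (q ^ m)"] have "Suc (q ^ m) \<le> c (m + Suc (q ^ m))" by simp
    also have "\<dots> \<le> c N" using False by (intro lift_Suc_mono_le[of c, OF c_Suc]) simp
    finally show False using cN by simp
  qed
  then obtain n where n: "m \<le> n" "n < Suc (m + q ^ m)" "c n = c (Suc n)" by blast
  \<comment> \<open>Dropping the last letter maps the words of length \<open>n + 1\<close> onto
    those of length \<open>n\<close>. With equal counts it is injective, so every word of length
    \<open>n\<close> has only one continuation.\<close>
  have inj: "inj_on (\<lambda>w. w mod q ^ n) (language q (Suc n) Y)"
    using n(3) by (intro eq_card_imp_inj_on fin) (simp add: language_truncate[OF Y(1)] c_def)
  have det: "agree (Suc n) y y'" if "y \<in> Y" "y' \<in> Y" "agree n y y'" for y y'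
  proof -
    have "word_num q n y 0 = word_num q n y' 0"
      using that by (subst agree_iff_word_num[symmetric]) (auto simp: lt)
    then have "word_num q (Suc n) y 0 mod q ^ n = word_num q (Suc n) y' 0 mod q ^ n"
      using that by (simp add: word_num_Suc_mod lt)
    moreover have "word_num q (Suc n) y 0 \<in> language q (Suc n) Y"
      "word_num q (Suc n) y' 0 \<in> language q (Suc n) Y"
      using that by (auto simp: language_def)
    ultimately have "word_num q (Suc n) y 0 = word_num q (Suc n) y' 0"
      by (rule inj_onD[OF inj])
    then show ?thesis using that by (subst agree_iff_word_num[of _ q]) (auto simp: lt)
  qed
  have window: "agree n y y' \<longleftrightarrow> agree N y y'" if "y \<in> Y" "y' \<in> Y" for y y'
    using agree_determines_longer[OF Y(2) det, of y y' "N - n"] that agree_mono[of N y y' n] n(2) False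
    by auto
  have "block_corr m n X Y R"
  proof (rule block_corr_change_windows[OF R])
    fix x y x' y' assume xy: "R x y" "R x' y'"
    then show "agree m x x' \<longleftrightarrow> agree n y y'"
      using window[of y y'] block_corr_memberD[OF R] block_corr_agreeD[OF R, OF xy] by blast
  qed
  then show ?thesis using n by auto
qed

section \<open>Shifts of finite type and block maps\<close>

lemma sft_shift_invariant: "shift_invariant (sft A F)"
proof -
  have "occurs_in w (shift k x) \<Longrightarrow> occurs_in w x" for w k and x :: "'a biword"
    unfolding occurs_in_def shift_def by (metis add.assoc add.commute)
  then show ?thesis by (auto simp: shift_invariant_def sft_def full_shift_def shift_def)
qed

lemma sft_subset_full_shift: "sft A F \<subseteq> full_shift A"
  by (auto simp: sft_def)

text \<open>A forbidden word in the glued word that starts at a negative position ends before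
  \<open>n\<close>, where the glued word is \<open>x\<close>; one that starts at 0 or later lies in
  \<open>x'\<close>, since the two words share the window in between.\<close>

lemma sft_gluing:
  assumes F: "\<And>w. w \<in> F \<Longrightarrow> length w \<le> Suc n"
  shows "gluing n (sft A F)"
  unfolding gluing_def
proof (intro ballI impI)
  fix x x' assume x: "x \<in> sft A F" "x' \<in> sft A F" and agr: "agree n x x'"
  define z where "z = (\<lambda>i. if i < int n then x i else x' i)"
  have z': "z i = x' i" if "i \<ge> 0" for i
    using agr that by (auto simp: z_def agree_def dest: spec[of _ "nat i"])
  have "\<not> occurs_in w z" if w: "w \<in> F" for w
  proof
    assume "occurs_in w z"
    then obtain i where i: "\<And>j. j < length w \<Longrightarrow> z (i + int j) = w ! j" by (auto simp: occurs_in_def)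
    have "occurs_in w x \<or> occurs_in w x'"
    proof (cases "i \<ge> 0")
      case True
      then show ?thesis using i z' by (auto simp: occurs_in_def)
    next
      case False
      then have "i + int j < int n" if "j < length w" for j using that F[OF w] by simp
      then show ?thesis using i by (auto simp: occurs_in_def z_def)
    qed
    then show False using x w by (auto simp: sft_def)
  qed
  then show "z \<in> sft A F" using x by (auto simp: sft_def full_shift_def z_def)
qed

text \<open>Comparing positions 0 and 1 makes \<open>h\<close> respect the overlaps of consecutive
  windows. The condition involves only words of length \<open>M + 1\<close> of \<open>X\<close> and
  \<open>N + 1\<close> of \<open>Y\<close>, hence is a finite one.\<close>

definition block_map :: "nat \<Rightarrow> nat biword set \<Rightarrow> nat \<Rightarrow> nat biword set \<Rightarrow> nat \<Rightarrow> (nat \<Rightarrow> nat) \<Rightarrow> (nat \<Rightarrow> nat) \<Rightarrow> bool"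
  where "block_map q X M Y N h h' \<longleftrightarrow> (\<forall>x\<in>X. \<exists>y\<in>Y.
      word_num q N y 0 = h (word_num q M x 0) \<and> word_num q N y 1 = h (word_num q M x 1) \<and>
      h' (h (word_num q M x 0)) = word_num q M x 0)"

lemma block_corr_imp_block_maps:
  assumes R: "block_corr M N X Y R" and X: "X \<subseteq> full_shift {..<q}" and Y: "Y \<subseteq> full_shift {..<q}"
  shows "\<exists>h h'. block_map q X M Y N h h' \<and> block_map q Y N X M h' h"
proof -
  obtain h where h: "\<And>x y i. R x y \<Longrightarrow> h (word_num q M x i) = word_num q N y i"
    using block_corr_code_map[OF R X Y] by blast
  obtain h' where h': "\<And>x y i. R x y \<Longrightarrow> h' (word_num q N y i) = word_num q M x i"
    using block_corr_code_map[OF block_corr_sym[OF R] Y X] by blast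
  have "block_map q X M Y N h h'"
    unfolding block_map_def
  proof
    fix x assume "x \<in> X"
    then obtain y where "R x y" using R by (auto simp: block_corr_def)
    moreover from this have "y \<in> Y" using R by (auto simp: block_corr_def)
    ultimately show "\<exists>y\<in>Y. word_num q N y 0 = h (word_num q M x 0) \<and>
        word_num q N y 1 = h (word_num q M x 1) \<and> h' (h (word_num q M x 0)) = word_num q M x 0"
      by (intro bexI[of _ y]) (simp_all add: h h')
  qed
  moreover have "block_map q Y N X M h' h"
    unfolding block_map_def
  proof
    fix y assume "y \<in> Y"
    then obtain x where "R x y" using R by (auto simp: block_corr_def)
    moreover from this have "x \<in> X" using R by (auto simp: block_corr_def)
    ultimately show "\<exists>x\<in>X. word_num q M x 0 = h' (word_num q N y 0) \<and>
        word_num q M x 1 = h' (word_num q N y 1) \<and> h (h' (word_num q N y 0)) = word_num q N y 0"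
      by (intro bexI[of _ x]) (simp_all add: h h')
  qed
  ultimately show ?thesis by blast
qed

lemma sft_subset_larger_full_shift: "A \<subseteq> A' \<Longrightarrow> sft A F \<subseteq> full_shift A'"
  by (auto simp: sft_def full_shift_def)

text \<open>Every forbidden word fits into a window of length \<open>n\<close>, and as
  \<open>n\<close> is positive the windows also show every letter.\<close>

lemma sft_window_closed:
  assumes n: "n \<ge> 1" and F: "\<And>w. w \<in> F \<Longrightarrow> length w \<le> n"
    and win: "\<And>i. \<exists>x'\<in>sft A F. \<forall>t<n. x (i + int t) = x' (int t)"
  shows "x \<in> sft A F"
proof -
  have "x i \<in> A" for i
  proof -
    obtain x' where x': "x' \<in> sft A F" "\<forall>t<n. x (i + int t) = x' (int t)" using win[of i] by blast
    then have "x i = x' 0" using n by force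
    then show ?thesis using full_shift_letter[OF sft_subset_full_shift x'(1)] by simp
  qed
  moreover have "\<not> occurs_in w x" if w: "w \<in> F" for w
  proof
    assume "occurs_in w x"
    then obtain i where i: "\<And>j. j < length w \<Longrightarrow> x (i + int j) = w ! j" by (auto simp: occurs_in_def)
    obtain x' where x': "x' \<in> sft A F" "\<forall>t<n. x (i + int t) = x' (int t)" using win[of i] by blast
    have "occurs_in w x'"
      unfolding occurs_in_def using i x'(2) F[OF w] by (intro exI[of _ 0]) simp
    then show False using x'(1) w by (simp add: sft_def)
  qed
  ultimately show ?thesis by (simp add: sft_def full_shift_def)
qed

text \<open>Applied at every position of \<open>x\<close>, the local condition yields words
  \<open>Z i\<close> of the target shift whose initial windows overlap. They chain up to a single
  word, which belongs to the shift because all its windows occur there.\<close>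

lemma block_map_extend:
  assumes h: "block_map q X M (sft B G) N h h'"
    and X: "X \<subseteq> full_shift {..<q}" "shift_invariant X" and B: "B \<subseteq> {..<q}"
    and G: "\<And>w. w \<in> G \<Longrightarrow> length w \<le> N" and x: "x \<in> X"
  shows "\<exists>y\<in>sft B G. \<forall>i. word_num q N y i = h (word_num q M x i) \<and>
    h' (word_num q N y i) = word_num q M x i"
proof -
  let ?Y = "sft B G"
  have q: "q > 0" using full_shift_letter[OF X(1) x, of 0] by simp
  have "\<forall>i. \<exists>y\<in>?Y. word_num q N y 0 = h (word_num q M x i) \<and>
      word_num q N y 1 = h (word_num q M x (i + 1)) \<and> h' (h (word_num q M x i)) = word_num q M x i"
  proof
    fix i
    have "shift i x \<in> X" using X(2) x by (simp add: shift_invariant_def)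
    with h obtain y where "y \<in> ?Y" "word_num q N y 0 = h (word_num q M (shift i x) 0)"
      "word_num q N y 1 = h (word_num q M (shift i x) 1)"
      "h' (h (word_num q M (shift i x) 0)) = word_num q M (shift i x) 0"
      unfolding block_map_def by blast
    then show "\<exists>y\<in>?Y. word_num q N y 0 = h (word_num q M x i) \<and>
      word_num q N y 1 = h (word_num q M x (i + 1)) \<and> h' (h (word_num q M x i)) = word_num q M x i"
      by (intro bexI[of _ y]) (simp_all add: word_num_shift add.commute)
  qed
  then obtain Z where Z: "\<And>i. Z i \<in> ?Y" "\<And>i. word_num q N (Z i) 0 = h (word_num q M x i)"
      "\<And>i. word_num q N (Z i) 1 = h (word_num q M x (i + 1))"
      "\<And>i. h' (h (word_num q M x i)) = word_num q M x i"
    by metis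
  have Z_less: "Z i j < q" for i j
    using full_shift_letter[OF sft_subset_full_shift Z(1)] B by blast
  \<comment> \<open>\<open>V i\<close> covers two consecutive image windows: its remainder is the
    image of the window of \<open>x\<close> at \<open>i\<close>, its quotient the image of the one
    at \<open>i + 1\<close>.\<close>
  define V where "V i = word_num q (Suc N) (Z i) 0" for i
  define y where "y = (\<lambda>i. V i mod q)"
  have V_mod: "V i mod q ^ N = h (word_num q M x i)" for i
    unfolding V_def word_num_Suc_mod[of "Z i" q, OF Z_less] by (rule Z(2))
  have "V i div q = V (i + 1) mod q ^ N" for i
    unfolding V_mod unfolding V_def word_num_Suc_div[of "Z i" q, OF Z_less] using Z(3)[of i] by simp
  then have path: "word_num q (Suc N) y i = V i" for i
    unfolding y_def using q
    by (intro word_num_path) (simp_all only: V_def word_num_less[of "Z i" q for i, OF Z_less])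
  have y_less: "y i < q" for i using q by (simp add: y_def)
  have "y \<in> ?Y"
  proof (rule sft_window_closed[of "Suc N"])
    show "length w \<le> Suc N" if "w \<in> G" for w using G[OF that] by simp
    show "\<exists>x'\<in>?Y. \<forall>t<Suc N. y (i + int t) = x' (int t)" for i
    proof
      show "Z i \<in> ?Y" by (rule Z(1))
      show "\<forall>t<Suc N. y (i + int t) = Z i (int t)"
        using path[of i] unfolding V_def word_num_eq_iff[of y q "Z i", OF y_less Z_less] by simp
    qed
  qed simp
  moreover have "word_num q N y i = h (word_num q M x i)" for i
    using V_mod[of i] word_num_Suc_mod[of y q N i, OF y_less] path[of i] by simp
  ultimately show ?thesis using Z(4) by (intro bexI[of _ y]) simp_all
qed

section \<open>From block maps back to similarity\<close>

fun list_num :: "nat \<Rightarrow> nat list \<Rightarrow> nat" where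
  "list_num q [] = 0"
| "list_num q (a # w) = a + q * list_num q w"

lemma list_num_block_code: "list_num q (block_code n x i) = word_num q n x i"
proof (induction n arbitrary: i)
  case (Suc n)
  have "block_code (Suc n) x i = x i # block_code n x (i + 1)"
    by (simp add: block_code_def map_upt_Suc add.assoc del: upt_Suc)
  then show ?case using Suc by (simp add: word_num.simps(2))
qed (simp add: block_code_def)

lemma projects_onto_if_code_map:
  assumes to: "\<And>x. x \<in> X \<Longrightarrow> \<exists>y\<in>Y. \<forall>i. word_num q N y i = h (word_num q M x i)"
    and onto: "\<And>y. y \<in> Y \<Longrightarrow> \<exists>x\<in>X. \<forall>i. word_num q N y i = h (word_num q M x i)"
    and Y: "Y \<subseteq> full_shift B" and B: "B \<subseteq> {..<q}" "B = {} \<Longrightarrow> A = {}" and M: "M \<ge> 1"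
  shows "projects_onto (block_alphabet M A) (block_presentation M X)
    (block_alphabet N B) (block_presentation N Y)"
proof -
  define d where "d w = map (digit q (h (list_num q w))) [0..<N]" for w
  \<comment> \<open>A projection must send the whole block alphabet into the other one. Blocks whose
    decoded image is not over \<open>B\<close> get a constant block; on blocks occurring in
    \<open>X\<close> the value is \<open>d w\<close>.\<close>
  define \<phi> where "\<phi> w = (if d w \<in> block_alphabet N B then d w else replicate N (SOME b. b \<in> B))" for w
  have \<phi>: "\<phi> \<circ> block_code M x = block_code N y"
    if y: "y \<in> Y" and eq: "\<forall>i. word_num q N y i = h (word_num q M x i)" for x y
  proof
    fix i
    have less: "y i < q" for i using full_shift_letter[OF Y y] B(1) by blast
    have "d (block_code M x i) = map (digit q (word_num q N y i)) [0..<N]"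
      by (simp add: d_def list_num_block_code eq)
    also have "\<dots> = block_code N y i"
      by (simp add: block_code_def word_num_digit[of y q, OF less])
    finally have "d (block_code M x i) = block_code N y i" .
    moreover have "block_code N y i \<in> block_alphabet N B"
      using full_shift_letter[OF Y y] by (auto simp: block_code_def block_alphabet_def)
    ultimately show "(\<phi> \<circ> block_code M x) i = block_code N y i" by (simp add: \<phi>_def)
  qed
  have "(\<lambda>u. \<phi> \<circ> u) ` block_presentation M X = block_presentation N Y"
  proof (intro equalityI subsetI)
    fix u assume "u \<in> (\<lambda>u. \<phi> \<circ> u) ` block_presentation M X"
    then obtain x where x: "x \<in> X" "u = \<phi> \<circ> block_code M x" by (auto simp: block_presentation_def)
    obtain y where "y \<in> Y" "\<forall>i. word_num q N y i = h (word_num q M x i)" using to[OF x(1)] by blast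
    then show "u \<in> block_presentation N Y"
      using \<phi>[of y x] x(2) by (auto simp: block_presentation_def)
  next
    fix u assume "u \<in> block_presentation N Y"
    then obtain y where y: "y \<in> Y" "u = block_code N y" by (auto simp: block_presentation_def)
    obtain x where "x \<in> X" "\<forall>i. word_num q N y i = h (word_num q M x i)" using onto[OF y(1)] by blast
    then have "u = \<phi> \<circ> block_code M x" "block_code M x \<in> block_presentation M X"
      using \<phi>[of y x] y by (auto simp: block_presentation_def)
    then show "u \<in> (\<lambda>u. \<phi> \<circ> u) ` block_presentation M X" by (rule image_eqI)
  qed
  moreover have "\<phi> ` block_alphabet M A \<subseteq> block_alphabet N B"
  proof (cases "B = {}")
    case True
    then have "block_alphabet M A = {}" using B(2) M by (auto simp: block_alphabet_def)
    then show ?thesis by simp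
  next
    case False
    then have "(SOME b. b \<in> B) \<in> B" by (simp add: some_in_eq)
    then have "replicate N (SOME b. b \<in> B) \<in> block_alphabet N B"
      by (auto simp: block_alphabet_def)
    then show ?thesis by (auto simp: \<phi>_def)
  qed
  ultimately show ?thesis unfolding projects_onto_def by (intro exI[of _ \<phi>] conjI)
qed

text \<open>As \<open>h'\<close> undoes \<open>h\<close> on the windows of \<open>x\<close>, the
  partner \<open>y\<close> of \<open>x\<close> shows both that \<open>h\<close> leads from
  \<open>x\<close> into the second shift and that \<open>h'\<close> reaches \<open>x\<close>. The
  two extensions together thus give both projections.\<close>

lemma similar_if_block_maps:
  assumes h: "block_map q (sft A F) M (sft B G) N h h'" "block_map q (sft B G) N (sft A F) M h' h"
    and AB: "A \<subseteq> {..<q}" "B \<subseteq> {..<q}" "A = {} \<longleftrightarrow> B = {}"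
    and F: "\<And>w. w \<in> F \<Longrightarrow> length w \<le> M" and G: "\<And>w. w \<in> G \<Longrightarrow> length w \<le> N"
    and MN: "M \<ge> 1" "N \<ge> 1"
  shows "similar (block_alphabet M A) (block_presentation M (sft A F))
    (block_alphabet N B) (block_presentation N (sft B G))"
proof -
  have sub: "sft A F \<subseteq> full_shift {..<q}" "sft B G \<subseteq> full_shift {..<q}"
    using AB(1,2) by (simp_all add: sft_subset_larger_full_shift)
  note ext = block_map_extend[OF h(1) sub(1) sft_shift_invariant AB(2) G]
    block_map_extend[OF h(2) sub(2) sft_shift_invariant AB(1) F]
  have XY: "\<exists>y\<in>sft B G. \<forall>i. word_num q N y i = h (word_num q M x i)"
    "\<exists>y\<in>sft B G. \<forall>i. word_num q M x i = h' (word_num q N y i)" if "x \<in> sft A F" for x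
    using ext(1)[OF _ that] by metis+
  have YX: "\<exists>x\<in>sft A F. \<forall>i. word_num q N y i = h (word_num q M x i)"
    "\<exists>x\<in>sft A F. \<forall>i. word_num q M x i = h' (word_num q N y i)" if "y \<in> sft B G" for y
    using ext(2)[OF _ that] by metis+
  show ?thesis
    unfolding similar_def
    using AB MN
    by (intro conjI projects_onto_if_code_map[where q = q and h = h]
        projects_onto_if_code_map[where q = q and h = h'] XY YX sft_subset_full_shift) auto
qed

section \<open>The decision procedure\<close>

text \<open>The bound \<open>c < f\<close> loses nothing, since the elements of
  \<open>set_decode f\<close> are below \<open>f\<close>. For \<open>n \<ge> 1\<close> an empty
  forbidden word excludes every code, as it occurs in every bi-infinite word.\<close>

definition allowed_code :: "nat \<Rightarrow> nat \<Rightarrow> nat \<Rightarrow> nat \<Rightarrow> nat \<Rightarrow> bool" where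
  "allowed_code q a f n w \<longleftrightarrow> (\<forall>j<n. digit q w j \<in> set_decode a) \<and>
     (\<forall>c<f. c \<in> set_decode f \<longrightarrow> (\<forall>i<n. i + length (list_decode c) \<le> n \<longrightarrow>
        (\<exists>j<length (list_decode c). digit q w (i + j) \<noteq> code_nth c j)))"

text \<open>Words have length \<open>n + 1\<close> and their first letter is the lowest digit, so \<open>w div q\<close> drops the first
  letter and \<open>w mod q ^ n\<close> the last one. The binary digits of \<open>s\<close> are the indicator function of a
  set of words.\<close>

definition language_code :: "nat \<Rightarrow> nat \<Rightarrow> nat \<Rightarrow> nat \<Rightarrow> nat \<Rightarrow> bool" where
  "language_code q a f n v \<longleftrightarrow> (\<exists>s<2 ^ (q ^ Suc n). digit 2 s v = 1 \<and>
     (\<forall>w<q ^ Suc n. digit 2 s w = 1 \<longrightarrow> allowed_code q a f (Suc n) w \<and>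
        (\<exists>w'<q ^ Suc n. digit 2 s w' = 1 \<and> w div q = w' mod q ^ n) \<and>
        (\<exists>w'<q ^ Suc n. digit 2 s w' = 1 \<and> w' div q = w mod q ^ n)))"

text \<open>\<open>H\<close> is the table of a map from \<open>M\<close>-words to
  \<open>N\<close>-words: its digit number \<open>v\<close> in base \<open>q ^ N\<close> is the
  image of \<open>v\<close>. \<open>H'\<close> is a table in the other direction.\<close>

definition block_map_code ::
  "nat \<Rightarrow> nat \<Rightarrow> nat \<Rightarrow> nat \<Rightarrow> nat \<Rightarrow> nat \<Rightarrow> nat \<Rightarrow> nat \<Rightarrow> nat \<Rightarrow> bool" where
  "block_map_code q a f M b g N H H' \<longleftrightarrow> (\<forall>v<q ^ Suc M. language_code q a f M v \<longrightarrow>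
     (\<exists>w<q ^ Suc N. language_code q b g N w \<and> w mod q ^ N = digit (q ^ N) H (v mod q ^ M) \<and>
        w div q = digit (q ^ N) H (v div q) \<and>
        digit (q ^ M) H' (digit (q ^ N) H (v mod q ^ M)) = v mod q ^ M))"

text \<open>The first conjunct is needed when both shifts are empty: there is no map from a nonempty block
  alphabet to an empty one.\<close>

definition conjugacy_code :: "nat \<Rightarrow> nat \<Rightarrow> nat \<Rightarrow> nat \<Rightarrow> nat \<Rightarrow> nat \<Rightarrow> bool" where
  "conjugacy_code q m a f b g \<longleftrightarrow> (a = 0 \<longleftrightarrow> b = 0) \<and>
     (\<exists>M<Suc (Suc (m + q ^ m)). \<exists>N<Suc (Suc (m + q ^ m)). m \<le> M \<and> m \<le> N \<and>
        (\<exists>H<(q ^ N) ^ (q ^ M). \<exists>H'<(q ^ M) ^ (q ^ N).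
           block_map_code q a f M b g N H H' \<and> block_map_code q b g N a f M H' H))"

text \<open>The four inputs are \<open>a\<close>, \<open>f\<close>, \<open>b\<close>,
  \<open>g\<close> in this order; the bounds \<open>q\<close> on the letters and \<open>m\<close> on
  the lengths of forbidden words are computed from them.\<close>

lemma decidable_conjugacy_code:
  "decidable 4 (\<lambda>e. conjugacy_code (e 0 + e 2 + 1) (e 1 + e 3 + 1) (e 0) (e 1) (e 2) (e 3))"
  unfolding conjugacy_code_def block_map_code_def language_code_def allowed_code_def digit_def
  by (intro recursive_arith recursive_div recursive_mod decidable_mem_set_decode
      recursive_code_nth recursive_code_length) simp_all

section \<open>Correctness of the finite tests\<close>

lemma less_set_decode_bound: "x \<in> set_decode a \<Longrightarrow> x < a"
proof -
  assume x: "x \<in> set_decode a"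
  have "2 ^ x \<le> (\<Sum>i\<in>set_decode a. 2 ^ i :: nat)"
    using x by (intro member_le_sum) auto
  then have "2 ^ x \<le> a" using set_decode_inverse[of a] by (simp add: set_encode_def)
  then show ?thesis using less_exp[of x] by linarith
qed

lemma allowed_code_word_num:
  assumes "\<And>i. x i < q"
  shows "allowed_code q a f n (word_num q n x i) \<longleftrightarrow> (\<forall>j<n. x (i + int j) \<in> set_decode a) \<and>
    (\<forall>u\<in>list_decode ` set_decode f. \<forall>k<n. k + length u \<le> n \<longrightarrow>
       (\<exists>j<length u. x (i + int k + int j) \<noteq> u ! j))"
proof -
  have "(\<forall>c<f. c \<in> set_decode f \<longrightarrow> P c) \<longleftrightarrow> (\<forall>c\<in>set_decode f. P c)" for P
    using less_set_decode_bound by blast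
  then show ?thesis
    unfolding allowed_code_def
    by (auto simp: word_num_digit[of x q, OF assms] code_nth_def add.assoc cong: conj_cong)
qed

lemma sft_allowed_code:
  assumes x: "x \<in> sft (set_decode a) (list_decode ` set_decode f)" and less: "\<And>i. x i < q"
  shows "allowed_code q a f n (word_num q n x i)"
proof -
  have "\<exists>j<length u. x (i + int k + int j) \<noteq> u ! j" if "u \<in> list_decode ` set_decode f" for u k
  proof (rule ccontr)
    assume "\<not> ?thesis"
    then have "occurs_in u x" unfolding occurs_in_def by (intro exI[of _ "i + int k"]) blast
    then show False using x that unfolding sft_def by blast
  qed
  then show ?thesis
    using full_shift_letter[OF sft_subset_full_shift x] by (simp add: allowed_code_word_num[of x q, OF less])
qed

lemma sft_if_allowed_code:
  assumes less: "\<And>i. x i < q" and n: "n \<ge> 1"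
    and F: "\<And>w. w \<in> list_decode ` set_decode f \<Longrightarrow> length w \<le> n"
    and allowed: "\<And>i. allowed_code q a f n (word_num q n x i)"
  shows "x \<in> sft (set_decode a) (list_decode ` set_decode f)"
proof -
  note allowed' = allowed[unfolded allowed_code_word_num[of x q, OF less]]
  have "x i \<in> set_decode a" for i
    using conjunct1[OF allowed'[of i]] n by force
  moreover have "\<not> occurs_in u x" if u: "u \<in> list_decode ` set_decode f" for u
  proof
    assume "occurs_in u x"
    then obtain i where i: "\<And>j. j < length u \<Longrightarrow> x (i + int j) = u ! j" by (auto simp: occurs_in_def)
    have "\<exists>j<length u. x (i + int 0 + int j) \<noteq> u ! j"
      using bspec[OF conjunct2[OF allowed'[of i]] u] n F[OF u] by (elim allE[of _ 0]) simp
    then show False using i by auto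
  qed
  ultimately show ?thesis by (simp add: sft_def full_shift_def)
qed

text \<open>In a set of allowed words closed under having successors and predecessors, every member
  extends to a bi-infinite path, and that path spells a word of the shift. Conversely, the words of
  length \<open>n + 1\<close> of the shift form such a set.\<close>

lemma language_code_iff:
  assumes a: "a < q" and F: "\<And>w. w \<in> list_decode ` set_decode f \<Longrightarrow> length w \<le> Suc n"
    and v: "v < q ^ Suc n"
  shows "language_code q a f n v \<longleftrightarrow>
    v \<in> language q (Suc n) (sft (set_decode a) (list_decode ` set_decode f))"
proof -
  let ?X = "sft (set_decode a) (list_decode ` set_decode f)"
  have X: "?X \<subseteq> full_shift {..<q}"
    using a by (intro sft_subset_larger_full_shift) (auto dest: less_set_decode_bound)
  have less: "x i < q" if "x \<in> ?X" for x i using full_shift_letter[OF X that, of i] by simp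
  have q: "q > 0" using a by simp
  show ?thesis
  proof
    assume "language_code q a f n v"
    then obtain s where s: "digit 2 s v = 1"
        "\<And>w. w < q ^ Suc n \<Longrightarrow> digit 2 s w = 1 \<Longrightarrow> allowed_code q a f (Suc n) w"
        "\<And>w. w < q ^ Suc n \<Longrightarrow> digit 2 s w = 1 \<Longrightarrow>
          \<exists>w'<q ^ Suc n. digit 2 s w' = 1 \<and> w div q = w' mod q ^ n"
        "\<And>w. w < q ^ Suc n \<Longrightarrow> digit 2 s w = 1 \<Longrightarrow>
          \<exists>w'<q ^ Suc n. digit 2 s w' = 1 \<and> w' div q = w mod q ^ n"
      unfolding language_code_def by blast
    define S where "S = {w. w < q ^ Suc n \<and> digit 2 s w = 1}"
    have "\<forall>w\<in>S. \<exists>w'\<in>S. w div q = w' mod q ^ n"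
      using s(3) unfolding S_def by blast
    then obtain succ where succ: "\<And>w. w \<in> S \<Longrightarrow> succ w \<in> S \<and> w div q = succ w mod q ^ n"
      by metis
    have "\<forall>w\<in>S. \<exists>w'\<in>S. w' div q = w mod q ^ n"
      using s(4) unfolding S_def by blast
    then obtain pre where pre: "\<And>w. w \<in> S \<Longrightarrow> pre w \<in> S \<and> pre w div q = w mod q ^ n"
      by metis
    have vS: "v \<in> S" using v s(1) by (simp add: S_def)
    have succS: "(succ ^^ k) v \<in> S" for k by (induction k) (auto simp: vS succ)
    have preS: "(pre ^^ k) v \<in> S" for k by (induction k) (auto simp: vS pre)
    \<comment> \<open>The path runs through \<open>v\<close> at 0, follows chosen successors to the
      right and chosen predecessors to the left.\<close>
    define V where "V i = (if i \<ge> 0 then (succ ^^ nat i) v else (pre ^^ nat (- i)) v)" for i :: int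
    have VS: "V i \<in> S" for i by (simp add: V_def succS preS)
    have step: "V i div q = V (i + 1) mod q ^ n" for i
    proof (cases "i \<ge> 0")
      case True
      then have "V (i + 1) = succ (V i)" by (simp add: V_def nat_add_distrib)
      then show ?thesis using succ[OF VS[of i]] by simp
    next
      case False
      then have "nat (- i) = Suc (nat (- (i + 1)))" by simp
      then have "V i = pre ((pre ^^ nat (- (i + 1))) v)" using False by (simp add: V_def)
      also have "(pre ^^ nat (- (i + 1))) v = V (i + 1)" using False by (simp add: V_def)
      finally show ?thesis using pre[OF VS[of "i + 1"]] by simp
    qed
    define x where "x = (\<lambda>i. V i mod q)"
    have xV: "word_num q (Suc n) x i = V i" for i
      unfolding x_def using q VS step by (intro word_num_path) (auto simp: S_def)
    have "x \<in> ?X"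
    proof (rule sft_if_allowed_code[of x q "Suc n"])
      show "x i < q" for i using q by (simp add: x_def)
      show "allowed_code q a f (Suc n) (word_num q (Suc n) x i)" for i
        unfolding xV using s(2) VS[of i] by (simp add: S_def)
    qed (use F in auto)
    moreover have "v = word_num q (Suc n) x 0" unfolding xV by (simp add: V_def)
    ultimately show "v \<in> language q (Suc n) ?X" by (auto simp: language_def)
  next
    assume vL: "v \<in> language q (Suc n) ?X"
    let ?L = "language q (Suc n) ?X"
    \<comment> \<open>The witness is the indicator of the whole language, written as a binary
      number.\<close>
    have "\<exists>s<2 ^ (q ^ Suc n). \<forall>w<q ^ Suc n. digit 2 s w = of_bool (w \<in> ?L)"
      by (intro exists_digits) (simp add: of_bool_def)
    then obtain s where s: "s < 2 ^ (q ^ Suc n)" "\<forall>w<q ^ Suc n. digit 2 s w = of_bool (w \<in> ?L)"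
      by blast
    have sL: "digit 2 s w = 1 \<longleftrightarrow> w \<in> ?L" if "w < q ^ Suc n" for w using s(2) that by simp
    have L: "\<exists>w'<q ^ Suc n. digit 2 s w' = 1 \<and> w div q = w' mod q ^ n"
        "\<exists>w'<q ^ Suc n. digit 2 s w' = 1 \<and> w' div q = w mod q ^ n"
        "allowed_code q a f (Suc n) w"
      if wL: "w \<in> ?L" for w
    proof -
      obtain x where x: "x \<in> ?X" "w = word_num q (Suc n) x 0" using wL by (auto simp: language_def)
      note xless = less[OF x(1)]
      have win: "word_num q (Suc n) x i < q ^ Suc n" "digit 2 s (word_num q (Suc n) x i) = 1" for i
      proof -
        show *: "word_num q (Suc n) x i < q ^ Suc n" by (rule word_num_less[of x q, OF xless])
        have "shift i x \<in> ?X" using sft_shift_invariant x(1) by (auto simp: shift_invariant_def)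
        then have "word_num q (Suc n) (shift i x) 0 \<in> ?L" unfolding language_def by (rule imageI)
        then show "digit 2 s (word_num q (Suc n) x i) = 1"
          using sL[OF *] by (simp add: word_num_shift)
      qed
      have mod_div: "word_num q (Suc n) x i mod q ^ n = word_num q n x i"
          "word_num q (Suc n) x i div q = word_num q n x (i + 1)" for i
        using word_num_Suc_mod[of x q n i, OF xless] word_num_Suc_div[of x q n i, OF xless] by auto
      show "\<exists>w'<q ^ Suc n. digit 2 s w' = 1 \<and> w div q = w' mod q ^ n"
        using win[of 1] by (intro exI[of _ "word_num q (Suc n) x 1"]) (simp add: x(2) mod_div)
      show "\<exists>w'<q ^ Suc n. digit 2 s w' = 1 \<and> w' div q = w mod q ^ n"
        using win[of "-1"] by (intro exI[of _ "word_num q (Suc n) x (-1)"]) (simp add: x(2) mod_div)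
      show "allowed_code q a f (Suc n) w"
        unfolding x(2) by (rule sft_allowed_code[OF x(1) xless])
    qed
    show "language_code q a f n v"
      unfolding language_code_def
    proof (rule exI[of _ s], intro conjI allI impI)
      show "s < 2 ^ (q ^ Suc n)" by (rule s(1))
      show "digit 2 s v = 1" using sL[OF v] vL by simp
    next
      fix w assume "w < q ^ Suc n" "digit 2 s w = 1"
      then have "w \<in> ?L" using sL by simp
      then show "allowed_code q a f (Suc n) w"
        "\<exists>w'<q ^ Suc n. digit 2 s w' = 1 \<and> w div q = w' mod q ^ n"
        "\<exists>w'<q ^ Suc n. digit 2 s w' = 1 \<and> w' div q = w mod q ^ n"
        by (rule L)+
    qed
  qed
qed

lemma block_map_code_iff:
  assumes ab: "a < q" "b < q"
    and F: "\<And>w. w \<in> list_decode ` set_decode f \<Longrightarrow> length w \<le> M"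
    and G: "\<And>w. w \<in> list_decode ` set_decode g \<Longrightarrow> length w \<le> N"
  shows "block_map_code q a f M b g N H H' \<longleftrightarrow>
    block_map q (sft (set_decode a) (list_decode ` set_decode f)) M
      (sft (set_decode b) (list_decode ` set_decode g)) N (digit (q ^ N) H) (digit (q ^ M) H')"
proof -
  let ?X = "sft (set_decode a) (list_decode ` set_decode f)"
  let ?Y = "sft (set_decode b) (list_decode ` set_decode g)"
  have less: "x i < q" if "x \<in> ?X \<union> ?Y" for x i
  proof -
    have "x i \<in> set_decode a \<union> set_decode b" using that by (auto simp: sft_def full_shift_def)
    then show ?thesis using ab less_set_decode_bound by (metis Un_iff order_less_trans)
  qed
  have F': "length w \<le> Suc M" if "w \<in> list_decode ` set_decode f" for w using F[OF that] by simp
  have G': "length w \<le> Suc N" if "w \<in> list_decode ` set_decode g" for w using G[OF that] by simp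
  have sub: "?X \<subseteq> full_shift {..<q}" "?Y \<subseteq> full_shift {..<q}"
    using ab by (auto intro!: sft_subset_larger_full_shift dest: less_set_decode_bound)
  have LX: "v < q ^ Suc M \<and> language_code q a f M v \<longleftrightarrow> v \<in> language q (Suc M) ?X" for v
    using language_code_iff[OF ab(1) F'] language_subset[OF sub(1)] by blast
  have LY: "v < q ^ Suc N \<and> language_code q b g N v \<longleftrightarrow> v \<in> language q (Suc N) ?Y" for v
    using language_code_iff[OF ab(2) G'] language_subset[OF sub(2)] by blast
  have X: "(\<forall>v<q ^ Suc M. language_code q a f M v \<longrightarrow> P v) \<longleftrightarrow> (\<forall>x\<in>?X. P (word_num q (Suc M) x 0))" for P
  proof -
    have "(\<forall>v<q ^ Suc M. language_code q a f M v \<longrightarrow> P v) \<longleftrightarrow> (\<forall>v\<in>language q (Suc M) ?X. P v)"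
      using LX by blast
    then show ?thesis by (simp only: language_def ball_simps)
  qed
  have Y: "(\<exists>w<q ^ Suc N. language_code q b g N w \<and> P w) \<longleftrightarrow> (\<exists>y\<in>?Y. P (word_num q (Suc N) y 0))" for P
  proof -
    have "(\<exists>w<q ^ Suc N. language_code q b g N w \<and> P w) \<longleftrightarrow> (\<exists>w\<in>language q (Suc N) ?Y. P w)"
      using LY by blast
    then show ?thesis by (simp only: language_def bex_simps)
  qed
  show ?thesis
    unfolding block_map_code_def block_map_def X Y
    by (intro ball_cong bex_cong refl) (simp add: word_num_Suc_mod word_num_Suc_div less)
qed

text \<open>Only values at windows that occur are ever used, and these values are again windows,
  hence in range. So an arbitrary map can be replaced by a table that is correct where the values
  are in range.\<close>

lemma block_map_cong:
  assumes h: "block_map q X M Y N h h'" and X: "X \<subseteq> full_shift {..<q}" and Y: "Y \<subseteq> full_shift {..<q}"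
    and k: "\<And>v. v < q ^ M \<Longrightarrow> h v < q ^ N \<Longrightarrow> k v = h v"
    and k': "\<And>v. v < q ^ N \<Longrightarrow> h' v < q ^ M \<Longrightarrow> k' v = h' v"
  shows "block_map q X M Y N k k'"
  unfolding block_map_def
proof
  fix x assume x: "x \<in> X"
  with h obtain y where y: "y \<in> Y" "word_num q N y 0 = h (word_num q M x 0)"
      "word_num q N y 1 = h (word_num q M x 1)" "h' (h (word_num q M x 0)) = word_num q M x 0"
    unfolding block_map_def by blast
  have x_less: "x i < q" for i using full_shift_letter[OF X x, of i] by simp
  have y_less: "y i < q" for i using full_shift_letter[OF Y y(1), of i] by simp
  note nums = word_num_less[of x q M, OF x_less] word_num_less[of y q N, OF y_less]
  have kh: "k (word_num q M x 0) = h (word_num q M x 0)" "k (word_num q M x 1) = h (word_num q M x 1)"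
    using k nums(1) nums(2)[of 0] nums(2)[of 1] y(2,3) by simp_all
  moreover have "k' (h (word_num q M x 0)) = h' (h (word_num q M x 0))"
    using k' nums(1)[of 0] nums(2)[of 0] y(2,4) by simp
  ultimately show "\<exists>y\<in>Y. word_num q N y 0 = k (word_num q M x 0) \<and>
      word_num q N y 1 = k (word_num q M x 1) \<and> k' (k (word_num q M x 0)) = word_num q M x 0"
    using y by (intro bexI[of _ y]) simp_all
qed

section \<open>Completeness of the bounded search\<close>

lemma exists_digits_of_map:
  assumes "q > (0::nat)"
  shows "\<exists>H<q ^ n. \<forall>v<n. h v < q \<longrightarrow> digit q H v = h v"
proof -
  have "\<exists>H<q ^ n. \<forall>v<n. digit q H v = (if h v < q then h v else 0)"
    using assms by (intro exists_digits) simp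
  then obtain H where "H < q ^ n" "\<forall>v<n. digit q H v = (if h v < q then h v else 0)" by blast
  then show ?thesis by (intro exI[of _ H]) simp
qed

lemma directly_conjugate_bounded:
  assumes AB: "finite A" "A \<subseteq> {..<q}" "B \<subseteq> {..<q}"
    and F: "\<And>w. w \<in> F \<Longrightarrow> length w \<le> m" and G: "\<And>w. w \<in> G \<Longrightarrow> length w \<le> m"
    and dc: "directly_conjugate A (sft A F) B (sft B G)"
  shows "\<exists>M N R. m \<le> M \<and> M \<le> Suc (m + q ^ m) \<and> m \<le> N \<and> N \<le> Suc (m + q ^ m) \<and>
    block_corr M N (sft A F) (sft B G) R"
proof -
  let ?X = "sft A F" and ?Y = "sft B G"
  obtain M N where MN: "M \<ge> 1" "N \<ge> 1" and sim: "similar (block_alphabet M A) (block_presentation M ?X)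
      (block_alphabet N B) (block_presentation N ?Y)"
    using dc unfolding directly_conjugate_def by blast
  obtain R where R: "block_corr M N ?X ?Y R"
    using similar_imp_block_corr[OF AB(1) sft_subset_full_shift sft_shift_invariant
        sft_shift_invariant sim] by blast
  \<comment> \<open>Raising both lengths by \<open>m\<close> brings them into the range where gluing
    holds.\<close>
  have "block_corr (m + M) (m + N) ?X ?Y R"
    using block_corr_add[OF R MN, of m] by (simp add: add.commute)
  moreover have "gluing n ?X" "gluing n ?Y" if "n \<ge> m" for n
    using order_trans[OF F that] order_trans[OF G that] by (auto intro!: sft_gluing le_SucI)
  ultimately obtain i j where R': "block_corr (m + i) (m + j) ?X ?Y R" "i = 0 \<or> j = 0"
    using block_corr_descent_to_corner by blast
  have X: "?X \<subseteq> full_shift {..<q}" and Y: "?Y \<subseteq> full_shift {..<q}"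
    using AB(2,3) by (simp_all add: sft_subset_larger_full_shift)
  show ?thesis
  proof (cases "i = 0")
    case True
    then obtain n where "m \<le> n" "n \<le> Suc (m + q ^ m)" "block_corr m n ?X ?Y R"
      using block_corr_bounded[OF _ _ X Y sft_shift_invariant, of m "m + j" R] R'(1) by auto
    then show ?thesis by (intro exI[of _ m] exI[of _ n] exI[of _ R]) simp
  next
    case False
    \<comment> \<open>Here the second shift has the window of length \<open>m\<close>, so the bound
      is applied with the sides exchanged.\<close>
    then have "block_corr m (m + i) ?Y ?X (\<lambda>y x. R x y)"
      using block_corr_sym[OF R'(1)] R'(2) by simp
    then obtain n where "m \<le> n" "n \<le> Suc (m + q ^ m)" "block_corr m n ?Y ?X (\<lambda>y x. R x y)"
      using block_corr_bounded[OF _ _ Y X sft_shift_invariant, of m "m + i" "\<lambda>y x. R x y"] by auto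
    then show ?thesis
      using block_corr_sym[of m n ?Y ?X "\<lambda>y x. R x y"]
      by (intro exI[of _ n] exI[of _ m] exI[of _ R]) simp
  qed
qed

lemma directly_conjugate_alphabets:
  assumes "directly_conjugate A X B Y"
  shows "A = {} \<longleftrightarrow> B = {}"
proof -
  obtain M N where MN: "M \<ge> 1" "N \<ge> 1" and sim: "similar (block_alphabet M A) (block_presentation M X)
      (block_alphabet N B) (block_presentation N Y)"
    using assms unfolding directly_conjugate_def by blast
  have "block_alphabet M A = {} \<longleftrightarrow> block_alphabet N B = {}"
    using sim unfolding similar_def projects_onto_def by blast
  moreover have "block_alphabet n C = {} \<longleftrightarrow> C = {}" if "n \<ge> 1" for n and C :: "'c set"
  proof
    assume "block_alphabet n C = {}"
    moreover have "replicate n c \<in> block_alphabet n C" if "c \<in> C" for c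
      using that by (auto simp: block_alphabet_def)
    ultimately show "C = {}" by blast
  next
    assume "C = {}"
    then show "block_alphabet n C = {}" using that by (auto simp: block_alphabet_def)
  qed
  ultimately show ?thesis using MN by metis
qed

lemma directly_conjugate_iff_code:
  assumes A: "A = set_decode a" and F: "F = list_decode ` set_decode f"
    and B: "B = set_decode b" and G: "G = list_decode ` set_decode g"
  shows "directly_conjugate A (sft A F) B (sft B G) \<longleftrightarrow>
    conjugacy_code (a + b + 1) (f + g + 1) a f b g"
proof -
  define q where "q = a + b + 1"
  \<comment> \<open>The elements of a decoded set are below its code, and a list is no longer than
    its code. The summand 1 makes all lengths from \<open>m\<close> on positive, as direct conjugacy
    demands.\<close>
  define m where "m = f + g + 1"
  have q: "a < q" "b < q" "0 < q" by (simp_all add: q_def)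
  have AB: "finite A" "A \<subseteq> {..<q}" "B \<subseteq> {..<q}"
    using less_set_decode_bound q by (fastforce simp: A B)+
  have FG: "length w \<le> m" if "w \<in> F \<union> G" for w
  proof -
    have "list_encode w \<in> set_decode f \<union> set_decode g" using that by (auto simp: F G)
    then have "list_encode w < f + g" using less_set_decode_bound by fastforce
    then show ?thesis using length_le_list_encode[of w] by (simp add: m_def)
  qed
  have len: "length w \<le> M" if "w \<in> F \<union> G" "m \<le> M" for w M using FG that order_trans by blast
  have empty: "a = 0 \<longleftrightarrow> A = {}" "b = 0 \<longleftrightarrow> B = {}"
    unfolding A B using set_decode_inverse set_encode_empty set_decode_zero by metis+
  have X: "sft A F \<subseteq> full_shift {..<q}" and Y: "sft B G \<subseteq> full_shift {..<q}"
    using AB(2,3) by (simp_all add: sft_subset_larger_full_shift)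
  have code: "block_map_code q a f M b g N H H' \<longleftrightarrow>
      block_map q (sft A F) M (sft B G) N (digit (q ^ N) H) (digit (q ^ M) H')"
    "block_map_code q b g N a f M H' H \<longleftrightarrow>
      block_map q (sft B G) N (sft A F) M (digit (q ^ M) H') (digit (q ^ N) H)"
    if "m \<le> M" "m \<le> N" for M N H H'
    unfolding A F B G using len that q
    by (intro block_map_code_iff; simp add: F G)+
  show ?thesis
  proof
    assume dc: "directly_conjugate A (sft A F) B (sft B G)"
    obtain M N R where MN: "m \<le> M" "M \<le> Suc (m + q ^ m)" "m \<le> N" "N \<le> Suc (m + q ^ m)"
      and R: "block_corr M N (sft A F) (sft B G) R"
      using directly_conjugate_bounded[OF AB _ _ dc, of m] FG by blast
    obtain h h' where h: "block_map q (sft A F) M (sft B G) N h h'"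
        "block_map q (sft B G) N (sft A F) M h' h"
      using block_corr_imp_block_maps[OF R X Y] by blast
    obtain H where H: "H < (q ^ N) ^ (q ^ M)" "\<forall>v<q ^ M. h v < q ^ N \<longrightarrow> digit (q ^ N) H v = h v"
      using exists_digits_of_map[of "q ^ N" "q ^ M" h] q by auto
    obtain H' where H': "H' < (q ^ M) ^ (q ^ N)" "\<forall>v<q ^ N. h' v < q ^ M \<longrightarrow> digit (q ^ M) H' v = h' v"
      using exists_digits_of_map[of "q ^ M" "q ^ N" h'] q by auto
    have "block_map q (sft A F) M (sft B G) N (digit (q ^ N) H) (digit (q ^ M) H')"
      by (rule block_map_cong[OF h(1) X Y]) (use H(2) H'(2) in auto)
    moreover have "block_map q (sft B G) N (sft A F) M (digit (q ^ M) H') (digit (q ^ N) H)"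
      by (rule block_map_cong[OF h(2) Y X]) (use H(2) H'(2) in auto)
    ultimately have "conjugacy_code q m a f b g"
      unfolding conjugacy_code_def empty
      using MN H(1) H'(1) directly_conjugate_alphabets[OF dc]
      by (intro conjI exI[of _ M] exI[of _ N] exI[of _ H] exI[of _ H']) (simp_all add: code)
    then show "conjugacy_code (a + b + 1) (f + g + 1) a f b g" by (simp add: q_def m_def)
  next
    assume "conjugacy_code (a + b + 1) (f + g + 1) a f b g"
    then have c: "conjugacy_code q m a f b g" by (simp add: q_def m_def)
    then obtain M N H H' where MN: "m \<le> M" "m \<le> N"
      and "block_map_code q a f M b g N H H'" "block_map_code q b g N a f M H' H"
      unfolding conjugacy_code_def by blast
    then have h: "block_map q (sft A F) M (sft B G) N (digit (q ^ N) H) (digit (q ^ M) H')"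
      "block_map q (sft B G) N (sft A F) M (digit (q ^ M) H') (digit (q ^ N) H)"
      using code[OF MN] by auto
    have "A = {} \<longleftrightarrow> B = {}" using c unfolding conjugacy_code_def empty by simp
    moreover have "M \<ge> 1" "N \<ge> 1" using MN by (simp_all add: m_def)
    ultimately have "similar (block_alphabet M A) (block_presentation M (sft A F))
        (block_alphabet N B) (block_presentation N (sft B G))"
      using similar_if_block_maps[OF h AB(2,3)] len MN by blast
    then show "directly_conjugate A (sft A F) B (sft B G)"
      unfolding directly_conjugate_def using \<open>M \<ge> 1\<close> \<open>N \<ge> 1\<close> by blast
  qed
qed

theorem theorem3:
  "\<exists>p :: recf. \<forall>(A :: nat set) (F :: nat list set) (B :: nat set) (G :: nat list set).
     sft_presentation A F \<longrightarrow> sft_presentation B G \<longrightarrow>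
     evals p [encode_alphabet A, encode_language F, encode_alphabet B, encode_language G]
       (if directly_conjugate A (sft A F) B (sft B G) then 1 else 0)"
proof -
  obtain p where p: "\<And>e. evals p (map e [0..<4])
      (of_bool (conjugacy_code (e 0 + e 2 + 1) (e 1 + e 3 + 1) (e 0) (e 1) (e 2) (e 3)))"
    using decidable_conjugacy_code unfolding decidable_def recursive_fn_def by blast
  show ?thesis
  proof (intro exI[of _ p] allI impI)
    fix A B :: "nat set" and F G :: "nat list set"
    assume AF: "sft_presentation A F" and BG: "sft_presentation B G"
    define a f b g where "a = encode_alphabet A" "f = encode_language F"
      "b = encode_alphabet B" "g = encode_language G"
    note defs = a_f_b_g_def
    have "A = set_decode a" "B = set_decode b" "F = list_decode ` set_decode f" "G = list_decode ` set_decode g"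
      using AF BG by (simp_all add: defs sft_presentation_def encode_alphabet_def encode_language_def image_image)
    then have "directly_conjugate A (sft A F) B (sft B G) \<longleftrightarrow>
        conjugacy_code (a + b + 1) (f + g + 1) a f b g"
      by (intro directly_conjugate_iff_code)
    \<comment> \<open>Indexing into the list of the four codes serves as the environment from which
      the program takes its arguments.\<close>
    moreover have "map ((!) [a, f, b, g]) [0..<4] = [a, f, b, g]"
      by (simp add: upt_rec)
    ultimately have "evals p [a, f, b, g] (if directly_conjugate A (sft A F) B (sft B G) then 1 else 0)"
      using p[of "(!) [a, f, b, g]"] by (simp add: of_bool_def)
    then show "evals p [encode_alphabet A, encode_language F, encode_alphabet B, encode_language G]
       (if directly_conjugate A (sft A F) B (sft B G) then 1 else 0)"
      by (simp add: defs)
  qed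
qed

end
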